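(* Let $B(0,R)$ be the ball of radius $R$ centered at the origin, and let $$\gamma=\begin{cases} p-N & \text{if } p>N,\\[4pt] \dfrac{sp-N}{s} & \text{if } p<N.\end{cases}$$ (i) Let $R>1$. For any $\beta<\gamma$, and $C>0$ fixed, there exist a non-negative weight $w$ and a nontrivial solution $u_\beta\in W^{1,p}_0(B(0,R))$ of $$-\Delta_p u=w(x)|u|^{p-2}u\ \text{ in }B(0,R),\qquad u=0\ \text{ on }\partial B(0,R),$$ such that the inequality $$\frac{C}{R^{\beta}}\le\|w\|_{L^1(B(0,R))}$$ does not hold. (ii) Let $0<R<1$. For any $\beta>\gamma$, and $C>0$ fixed, there exist a non-negative weight $w$ and a nontrivial solution $u_\beta\in W^{1,p}_0(B(0,R))$ of $$-\Delta_p u=w(x)|u|^{p-2}u\ \text{ in }B(0,R),\qquad u=0\ \text{ on }\partial B(0,R),$$ such that the inequality $$\frac{C}{R^{\beta}}\le\|w\|_{L^1(B(0,R))}$$ does not hold.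
   Context: Here $1<p<\infty$, $p\neq N$, $B(0,R)\subset\mathbb{R}^N$, and $\Delta_p u=\operatorname{div}(|\nabla u|^{p-2}\nabla u)$ is the $p$-Laplacian. When $p<N$, $s$ is an exponent with $s>N/p$. Weights $w$ are taken in $L^1$ of the domain when $p>N$ and in $L^s$ of the domain when $p<N$. Solutions in a domain $\Omega$ are understood in the weak sense: $u\in W^{1,p}_0(\Omega)$ and $\int_\Omega|\nabla u|^{p-2}\nabla u\cdot\nabla\varphi\,dx=\int_\Omega w|u|^{p-2}u\,\varphi\,dx$ for every $\varphi\in W^{1,p}_0(\Omega)$; nontrivial means $u\not\equiv0$.
   Formalization: For p>N the claim is proved for all R>R0 in (i) and all 0<R<R0 in (ii), with R0 depending on β and C, since for fixed R it is false (N=1, p=2, R=2, β=0, C=1/2: Lyapunov gives ‖w‖₁≥1). For p<N every R is covered as stated. *)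

theory Defs
  imports "HOL-Analysis.Analysis"
begin

text \<open>
  Functions on a domain \<open>\<Omega>\<close> are total functions on the ambient space of which only the values
  on \<open>\<Omega>\<close> matter; all integrals are taken with respect to \<open>lebesgue_on \<Omega>\<close>.
\<close>

definition in_Lp :: "real \<Rightarrow> 'a::euclidean_space set \<Rightarrow> ('a \<Rightarrow> 'b::euclidean_space) \<Rightarrow> bool" where
  "in_Lp q \<Omega> f \<longleftrightarrow>
     f \<in> borel_measurable (lebesgue_on \<Omega>) \<and>
     integrable (lebesgue_on \<Omega>) (\<lambda>x. norm (f x) powr q)"

definition Lp_norm :: "real \<Rightarrow> 'a::euclidean_space set \<Rightarrow> ('a \<Rightarrow> 'b::euclidean_space) \<Rightarrow> real" where
  "Lp_norm q \<Omega> f = (integral\<^sup>L (lebesgue_on \<Omega>) (\<lambda>x. norm (f x) powr q)) powr (1 / q)"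

definition partial_deriv :: "'a::euclidean_space \<Rightarrow> ('a \<Rightarrow> real) \<Rightarrow> 'a \<Rightarrow> real" where
  "partial_deriv b f x = frechet_derivative f (at x) b"

definition grad :: "('a::euclidean_space \<Rightarrow> real) \<Rightarrow> 'a \<Rightarrow> 'a" where
  "grad f x = (\<Sum>b\<in>Basis. partial_deriv b f x *\<^sub>R b)"

fun C_k :: "nat \<Rightarrow> ('a::euclidean_space \<Rightarrow> real) \<Rightarrow> bool" where
  "C_k 0 f \<longleftrightarrow> continuous_on UNIV f"
| "C_k (Suc k) f \<longleftrightarrow>
     (\<forall>x. f differentiable (at x)) \<and> (\<forall>b\<in>Basis. C_k k (partial_deriv b f))"

text \<open>The space of smooth functions with compact support in \<open>\<Omega>\<close>, extended by zero.\<close>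

definition test_function :: "'a::euclidean_space set \<Rightarrow> ('a \<Rightarrow> real) \<Rightarrow> bool" where
  "test_function \<Omega> \<phi> \<longleftrightarrow>
     (\<forall>k. C_k k \<phi>) \<and> (\<exists>K. compact K \<and> K \<subseteq> \<Omega> \<and> (\<forall>x. x \<notin> K \<longrightarrow> \<phi> x = 0))"

definition has_weak_gradient ::
  "'a::euclidean_space set \<Rightarrow> ('a \<Rightarrow> real) \<Rightarrow> ('a \<Rightarrow> 'a) \<Rightarrow> bool" where
  "has_weak_gradient \<Omega> u Du \<longleftrightarrow>
     (\<forall>K. compact K \<and> K \<subseteq> \<Omega> \<longrightarrow> u absolutely_integrable_on K \<and> Du absolutely_integrable_on K) \<and>
     (\<forall>\<phi>. test_function \<Omega> \<phi> \<longrightarrow> (\<forall>b\<in>Basis.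
        integral\<^sup>L (lebesgue_on \<Omega>) (\<lambda>x. u x * partial_deriv b \<phi> x) =
        - integral\<^sup>L (lebesgue_on \<Omega>) (\<lambda>x. (Du x \<bullet> b) * \<phi> x)))"

text \<open>
  The Sobolev spaces are presented as relations: \<open>W1p p \<Omega> u Du\<close> says that \<open>u\<close> belongs to
  $W^{1,p}(\Omega)$ and that \<open>Du\<close> is (a representative of) its weak gradient. The space with
  zero boundary values is the closure of the test functions in the $W^{1,p}$ norm.
\<close>

definition W1p :: "real \<Rightarrow> 'a::euclidean_space set \<Rightarrow> ('a \<Rightarrow> real) \<Rightarrow> ('a \<Rightarrow> 'a) \<Rightarrow> bool" where
  "W1p p \<Omega> u Du \<longleftrightarrow> in_Lp p \<Omega> u \<and> in_Lp p \<Omega> Du \<and> has_weak_gradient \<Omega> u Du"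

definition W1p_zero :: "real \<Rightarrow> 'a::euclidean_space set \<Rightarrow> ('a \<Rightarrow> real) \<Rightarrow> ('a \<Rightarrow> 'a) \<Rightarrow> bool" where
  "W1p_zero p \<Omega> u Du \<longleftrightarrow>
     W1p p \<Omega> u Du \<and>
     (\<exists>\<phi> :: nat \<Rightarrow> 'a \<Rightarrow> real.
        (\<forall>n. test_function \<Omega> (\<phi> n)) \<and>
        (\<lambda>n. Lp_norm p \<Omega> (\<lambda>x. u x - \<phi> n x)) \<longlonglongrightarrow> 0 \<and>
        (\<lambda>n. Lp_norm p \<Omega> (\<lambda>x. Du x - grad (\<phi> n) x)) \<longlonglongrightarrow> 0)"

text \<open>
  Weak solutions of $-\Delta_p u = w |u|^{p-2} u$ in \<open>\<Omega>\<close>, $u = 0$ on the boundary. The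
  integrability requirements make explicit that both integrals in the weak formulation exist
  (the Bochner integral of a non-integrable function is \<open>0\<close> by convention). Where the argument
  of \<open>powr (p - 2)\<close> vanishes, so does the whole product, also for $p < 2$.
\<close>

definition weak_solution ::
  "real \<Rightarrow> 'a::euclidean_space set \<Rightarrow> ('a \<Rightarrow> real) \<Rightarrow> ('a \<Rightarrow> real) \<Rightarrow> bool" where
  "weak_solution p \<Omega> w u \<longleftrightarrow>
     (\<exists>Du. W1p_zero p \<Omega> u Du \<and>
       (\<forall>\<phi> D\<phi>. W1p_zero p \<Omega> \<phi> D\<phi> \<longrightarrow>
          integrable (lebesgue_on \<Omega>) (\<lambda>x. (norm (Du x) powr (p - 2) *\<^sub>R Du x) \<bullet> D\<phi> x) \<and>
          integrable (lebesgue_on \<Omega>) (\<lambda>x. w x * \<bar>u x\<bar> powr (p - 2) * u x * \<phi> x) \<and>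
          integral\<^sup>L (lebesgue_on \<Omega>) (\<lambda>x. (norm (Du x) powr (p - 2) *\<^sub>R Du x) \<bullet> D\<phi> x) =
          integral\<^sup>L (lebesgue_on \<Omega>) (\<lambda>x. w x * \<bar>u x\<bar> powr (p - 2) * u x * \<phi> x)))"

definition nontrivial_on :: "'a::euclidean_space set \<Rightarrow> ('a \<Rightarrow> real) \<Rightarrow> bool" where
  "nontrivial_on \<Omega> u \<longleftrightarrow> \<not> (AE x in lebesgue_on \<Omega>. u x = 0)"

definition admissible_weight ::
  "real \<Rightarrow> real \<Rightarrow> 'a::euclidean_space set \<Rightarrow> ('a \<Rightarrow> real) \<Rightarrow> bool" where
  "admissible_weight p s \<Omega> w \<longleftrightarrow>
     (if p > real DIM('a) then in_Lp 1 \<Omega> w else in_Lp s \<Omega> w)"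

definition gamma_exponent :: "real \<Rightarrow> real \<Rightarrow> real \<Rightarrow> real" where
  "gamma_exponent N p s = (if p > N then p - N else (s * p - N) / s)"

end

theory Submission
  imports Defs
begin

text \<open>
  For $0 < 4a \le R^2$ there is a radial solution on the ball of radius $R$ that is constant for
  $|x|^2 \le a$ and $p$-harmonic for $|x|^2 \ge 2a$. Its vector field
  $|\nabla u|^{p-2} \nabla u$ is $-S(|x|^2)\, |x|^{-N} x$ for a step function $S$ rising from 0 to 1
  on $[a, 2a]$. The weight $-\Delta_p u / u^{p-1}$ is therefore bounded, non-negative and supported in the shell $a \le |x|^2 \le 2a$, and its $L^1$ norm is at
  most $K a^{(N-p)/2}$ with $K$ independent of $a$ and $R$. For $p < N$ this tends to 0 as
  $a \to 0$ with $R$ fixed; for $p > N$ the choice $a = R^2/4$ gives a multiple of $R^{N-p}$.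
  Since the vector field and $w u^{p-1}$ are bounded, the weak formulation passes by density from
  smooth test functions, for which it is an integration by parts, to all of $W^{1,p}_0$.
\<close>

subsection \<open>Convergence in Lebesgue spaces on sets of finite measure\<close>

text \<open>The power of a arises as follows. The divergence of the field is of size a^(-N/2) on the
  shell, whose volume is at most of order a^(N/2). There u is at least its drop between |x|^2 = 2a
  and |x|^2 = 4a, for which the condition 4a <= R^2 makes room; the (p-1)-st power of this drop is a
  constant times a^((p-N)/2).

  For p > N a threshold for R that depends on \<beta> and C is unavoidable: by Morrey's inequality
  every nontrivial solution with non-negative w satisfies ||w||_1 >= c R^(N-p), so a small C cannot
  be beaten at R close to 1. For p < N concentration near the origin makes the L^1 norm as small as
  desired at each R.

  Membership in W^{1,p}_0 asks for smooth compactly supported approximants of u, which itself is not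
  smooth; building them takes a large share of the work. Radial functions are written in the
  variable t = |x|^2, which is smooth at the origin, unlike |x|.\<close>

lemma integrable_lebesgue_on_bounded:
  fixes f :: "'a::euclidean_space \<Rightarrow> 'b::euclidean_space"
  assumes "\<Omega> \<in> lmeasurable" "f \<in> borel_measurable (lebesgue_on \<Omega>)"
    and "\<And>x. x \<in> \<Omega> \<Longrightarrow> norm (f x) \<le> B"
  shows "integrable (lebesgue_on \<Omega>) f"
  by (rule finite_measure.integrable_const_bound[OF finite_measure_lebesgue_on[OF assms(1)],
        where B = B])
    (use assms in \<open>auto intro!: AE_I2\<close>)

lemma borel_measurable_lebesgue_on_continuous:
  fixes f :: "'a::euclidean_space \<Rightarrow> 'b::euclidean_space"
  assumes "continuous_on UNIV f"
  shows "f \<in> borel_measurable (lebesgue_on \<Omega>)"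
  by (rule measurable_restrict_space1)
    (use borel_measurable_continuous_onI[OF assms] in \<open>auto intro: measurable_completion\<close>)

lemma in_Lp_bounded:
  fixes f :: "'a::euclidean_space \<Rightarrow> 'b::euclidean_space"
  assumes "\<Omega> \<in> lmeasurable" "f \<in> borel_measurable (lebesgue_on \<Omega>)" "0 \<le> q"
    and "\<And>x. x \<in> \<Omega> \<Longrightarrow> norm (f x) \<le> B"
  shows "in_Lp q \<Omega> f"
  unfolding in_Lp_def
proof
  show "integrable (lebesgue_on \<Omega>) (\<lambda>x. norm (f x) powr q)"
    using assms(1)
  proof (rule integrable_lebesgue_on_bounded[where B = "B powr q"])
    show "(\<lambda>x. norm (f x) powr q) \<in> borel_measurable (lebesgue_on \<Omega>)"
      using assms(2) by measurable
    show "\<And>x. x \<in> \<Omega> \<Longrightarrow> norm (norm (f x) powr q) \<le> B powr q"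
      using assms by (auto intro!: powr_mono2)
  qed
qed fact

lemma in_Lp_imp_integrable:
  fixes f :: "'a::euclidean_space \<Rightarrow> 'b::euclidean_space"
  assumes "\<Omega> \<in> lmeasurable" "in_Lp p \<Omega> f" "1 \<le> p"
  shows "integrable (lebesgue_on \<Omega>) f"
proof -
  interpret finite_measure "lebesgue_on \<Omega>"
    using assms(1) by (rule finite_measure_lebesgue_on)
  have "integrable (lebesgue_on \<Omega>) (\<lambda>x. 1 + norm (f x) powr p)"
    using assms(2) by (auto simp: in_Lp_def)
  then show ?thesis
  proof (rule Bochner_Integration.integrable_bound)
    show "f \<in> borel_measurable (lebesgue_on \<Omega>)"
      using assms(2) by (auto simp: in_Lp_def)
    have "norm y \<le> 1 + norm y powr p" for y :: 'b
    proof (cases "norm y \<le> 1")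
      case False
      then have "norm y powr 1 \<le> norm y powr p"
        using assms(3) by (intro powr_mono) auto
      then show ?thesis using False by simp
    qed (simp add: add_increasing2)
    then show "AE x in lebesgue_on \<Omega>. norm (f x) \<le> norm (1 + norm (f x) powr p)"
      by (auto intro!: AE_I2 simp: abs_of_nonneg)
  qed
qed

lemma in_Lp_diff:
  fixes f g :: "'a::euclidean_space \<Rightarrow> 'b::euclidean_space"
  assumes f: "in_Lp p \<Omega> f" and g: "in_Lp p \<Omega> g" and "0 \<le> p"
  shows "in_Lp p \<Omega> (\<lambda>x. f x - g x)"
  unfolding in_Lp_def
proof
  show m: "(\<lambda>x. f x - g x) \<in> borel_measurable (lebesgue_on \<Omega>)"
    using f g by (auto simp: in_Lp_def)
  have "integrable (lebesgue_on \<Omega>)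
      (\<lambda>x. 2 powr p * norm (f x) powr p + 2 powr p * norm (g x) powr p)"
    using f g by (auto simp: in_Lp_def)
  then show "integrable (lebesgue_on \<Omega>) (\<lambda>x. norm (f x - g x) powr p)"
  proof (rule Bochner_Integration.integrable_bound)
    show "(\<lambda>x. norm (f x - g x) powr p) \<in> borel_measurable (lebesgue_on \<Omega>)"
      using m by measurable
    \<comment> \<open>Bounding both terms by their maximum gives a crude constant but bypasses
      Minkowski's inequality; only integrability is at stake.\<close>
    have "norm (y - z) powr p \<le> 2 powr p * norm y powr p + 2 powr p * norm z powr p"
      for y z :: 'b
    proof -
      have "norm (y - z) \<le> 2 * max (norm y) (norm z)"
        using norm_triangle_ineq4[of y z] by linarith
      then have "norm (y - z) powr p \<le> (2 * max (norm y) (norm z)) powr p"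
        using \<open>0 \<le> p\<close> by (intro powr_mono2) auto
      also have "\<dots> = 2 powr p * max (norm y) (norm z) powr p"
        by (simp add: powr_mult)
      also have "\<dots> \<le> 2 powr p * (norm y powr p + norm z powr p)"
        by (intro mult_left_mono) (auto simp: max_def)
      finally show ?thesis by (simp add: algebra_simps)
    qed
    then show "AE x in lebesgue_on \<Omega>. norm (norm (f x - g x) powr p)
        \<le> norm (2 powr p * norm (f x) powr p + 2 powr p * norm (g x) powr p)"
      by (auto intro!: AE_I2 simp: abs_of_nonneg)
  qed
qed

lemma Lp_norm_bounded_tendsto_0:
  fixes f :: "nat \<Rightarrow> 'a::euclidean_space \<Rightarrow> 'b::euclidean_space"
  assumes "\<Omega> \<in> lmeasurable" "0 < p"
    and m: "\<And>n. f n \<in> borel_measurable (lebesgue_on \<Omega>)"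
    and B: "\<And>n x. x \<in> \<Omega> \<Longrightarrow> norm (f n x) \<le> B"
    and lim: "\<And>x. x \<in> \<Omega> \<Longrightarrow> (\<lambda>n. f n x) \<longlonglongrightarrow> 0"
  shows "(\<lambda>n. Lp_norm p \<Omega> (f n)) \<longlonglongrightarrow> 0"
proof -
  interpret finite_measure "lebesgue_on \<Omega>"
    using assms(1) by (rule finite_measure_lebesgue_on)
  have "(\<lambda>n. integral\<^sup>L (lebesgue_on \<Omega>) (\<lambda>x. norm (f n x) powr p)) \<longlonglongrightarrow>
      integral\<^sup>L (lebesgue_on \<Omega>) (\<lambda>x. 0)"
  proof (rule integral_dominated_convergence[where w = "\<lambda>x. B powr p"])
    show "\<And>n. (\<lambda>x. norm (f n x) powr p) \<in> borel_measurable (lebesgue_on \<Omega>)"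
      using m by measurable
    show "AE x in lebesgue_on \<Omega>. (\<lambda>n. norm (f n x) powr p) \<longlonglongrightarrow> 0"
    proof (rule AE_I2)
      fix x assume "x \<in> space (lebesgue_on \<Omega>)"
      then have "(\<lambda>n. norm (f n x)) \<longlonglongrightarrow> 0"
        using lim[of x] by (simp add: tendsto_norm_zero)
      then show "(\<lambda>n. norm (f n x) powr p) \<longlonglongrightarrow> 0"
        using tendsto_powr'[of "\<lambda>n. norm (f n x)" 0 sequentially "\<lambda>_. p" p] \<open>0 < p\<close> by simp
    qed
    show "AE x in lebesgue_on \<Omega>. norm (norm (f n x) powr p) \<le> B powr p" for n
      using B \<open>0 < p\<close> by (auto intro!: AE_I2 powr_mono2)
  qed auto
  then have "(\<lambda>n. integral\<^sup>L (lebesgue_on \<Omega>) (\<lambda>x. norm (f n x) powr p)) \<longlonglongrightarrow> 0"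
    by simp
  then show ?thesis
    unfolding Lp_norm_def
    using tendsto_powr'[of "\<lambda>n. integral\<^sup>L (lebesgue_on \<Omega>) (\<lambda>x. norm (f n x) powr p)" 0
        sequentially "\<lambda>_. 1 / p" "1 / p"] \<open>0 < p\<close>
    by (simp add: integral_nonneg)
qed

text \<open>An elementary substitute for Hoelder's inequality: where |y| > \<delta>, |y| = |y|^(1-p)
  |y|^p <= \<delta>^(1-p) |y|^p, and elsewhere |y| <= \<delta>. Integrating gives
  \<open>key\<close>, in which \<delta> is fixed first and n is sent to infinity afterwards.\<close>

lemma Lp_norm_tendsto_0_imp_L1:
  fixes f :: "nat \<Rightarrow> 'a::euclidean_space \<Rightarrow> 'b::euclidean_space"
  assumes \<Omega>: "\<Omega> \<in> lmeasurable" and p: "1 \<le> p" and f: "\<And>n. in_Lp p \<Omega> (f n)"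
    and lim: "(\<lambda>n. Lp_norm p \<Omega> (f n)) \<longlonglongrightarrow> 0"
  shows "(\<lambda>n. integral\<^sup>L (lebesgue_on \<Omega>) (\<lambda>x. norm (f n x))) \<longlonglongrightarrow> 0"
proof -
  interpret finite_measure "lebesgue_on \<Omega>"
    using \<Omega> by (rule finite_measure_lebesgue_on)
  define I where "I n = integral\<^sup>L (lebesgue_on \<Omega>) (\<lambda>x. norm (f n x) powr p)" for n
  define m where "m = measure lebesgue \<Omega>"
  have I0: "0 \<le> I n" for n unfolding I_def by (simp add: integral_nonneg)
  have "(\<lambda>n. (I n powr (1 / p)) powr p) \<longlonglongrightarrow> 0 powr p"
    using lim p unfolding Lp_norm_def I_def[symmetric]
    by (intro tendsto_powr') auto
  then have I: "I \<longlonglongrightarrow> 0"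
    using p I0 by (simp add: powr_powr)
  have key: "integral\<^sup>L (lebesgue_on \<Omega>) (\<lambda>x. norm (f n x)) \<le> \<delta> * m + \<delta> powr (1 - p) * I n"
    if "\<delta> > 0" for n \<delta>
  proof -
    have *: "norm y \<le> \<delta> + \<delta> powr (1 - p) * norm y powr p" for y :: 'b
    proof (cases "norm y \<le> \<delta>")
      case False
      then have "norm y powr (1 - p) \<le> \<delta> powr (1 - p)"
        using \<open>\<delta> > 0\<close> p by (intro powr_mono2') auto
      then have "norm y powr (1 - p) * norm y powr p \<le> \<delta> powr (1 - p) * norm y powr p"
        by (intro mult_right_mono) auto
      moreover have "norm y powr (1 - p) * norm y powr p = norm y"
        using False \<open>\<delta> > 0\<close> by (simp flip: powr_add)
      ultimately show ?thesis using \<open>\<delta> > 0\<close> by simp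
    qed (simp add: add_increasing2)
    have i: "integrable (lebesgue_on \<Omega>) (\<lambda>x. norm (f n x) powr p)"
      using f[of n] by (simp add: in_Lp_def)
    have "integral\<^sup>L (lebesgue_on \<Omega>) (\<lambda>x. norm (f n x)) \<le>
        integral\<^sup>L (lebesgue_on \<Omega>) (\<lambda>x. \<delta> + \<delta> powr (1 - p) * norm (f n x) powr p)"
      using i * in_Lp_imp_integrable[OF \<Omega> f p] by (intro integral_mono) auto
    also have "\<dots> = \<delta> * m + \<delta> powr (1 - p) * I n"
      using i \<Omega> by (simp add: I_def m_def measure_restrict_space space_restrict_space)
    finally show ?thesis .
  qed
  show ?thesis
  proof (rule LIMSEQ_I)
    fix r :: real assume "0 < r"
    \<comment> \<open>This makes the first term of \<open>key\<close> at most r / 2; the summand 1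
      guards against m = 0.\<close>
    define \<delta> where "\<delta> = r / (2 * (m + 1))"
    have m0: "0 \<le> m" by (simp add: m_def)
    have \<delta>: "\<delta> > 0" "\<delta> * m \<le> r / 2"
      using \<open>0 < r\<close> m0 by (auto simp: \<delta>_def field_simps intro: add_nonneg_pos)
    have "(\<lambda>n. \<delta> powr (1 - p) * I n) \<longlonglongrightarrow> 0"
      using tendsto_mult_right_zero[OF I] by blast
    then obtain n0 where n0: "\<And>n. n \<ge> n0 \<Longrightarrow> \<bar>\<delta> powr (1 - p) * I n\<bar> < r / 2"
      using LIMSEQ_D[of _ 0 "r / 2"] \<open>0 < r\<close> by fastforce
    then have "integral\<^sup>L (lebesgue_on \<Omega>) (\<lambda>x. norm (f n x)) < r" if "n \<ge> n0" for n
      using key[OF \<delta>(1), of n] \<delta>(2) n0[OF that] by linarith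
    then show "\<exists>n0. \<forall>n\<ge>n0. norm (integral\<^sup>L (lebesgue_on \<Omega>) (\<lambda>x. norm (f n x)) - 0) < r"
      by (auto simp: integral_nonneg abs_of_nonneg)
  qed
qed

subsection \<open>Integration by parts against test functions\<close>

lemma has_real_derivative_along_line:
  fixes F :: "'a::real_normed_vector \<Rightarrow> real"
  assumes "\<And>x. (F has_derivative F' x) (at x)"
  shows "((\<lambda>t. F (x + t *\<^sub>R b)) has_real_derivative F' (x + t *\<^sub>R b) b) (at t)"
proof -
  have "((\<lambda>t. F (x + t *\<^sub>R b)) has_derivative (\<lambda>h. F' (x + t *\<^sub>R b) (h *\<^sub>R b))) (at t)"
    by (rule has_derivative_compose[OF _ assms]) (auto intro!: derivative_eq_intros)
  moreover have "F' (x + t *\<^sub>R b) (h *\<^sub>R b) = F' (x + t *\<^sub>R b) b * h" for h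
    using linear_scale[OF has_derivative_linear[OF assms]] by simp
  ultimately show ?thesis
    by (simp add: has_field_derivative_def)
qed

lemma integrable_lborel_compact_support:
  fixes g :: "'a::euclidean_space \<Rightarrow> real"
  assumes "continuous_on UNIV g" "compact K" "\<And>x. x \<notin> K \<Longrightarrow> g x = 0"
  shows "integrable lborel g"
proof -
  have "integrable lborel (\<lambda>x. indicator K x *\<^sub>R g x)"
    using assms by (intro borel_integrable_compact) (auto intro: continuous_on_subset)
  moreover have "(\<lambda>x. indicator K x *\<^sub>R g x) = g"
    using assms(3) by (intro ext) (auto simp: indicator_def)
  ultimately show ?thesis by simp
qed

lemma compact_support_lebesgue_on:
  fixes g :: "'a::euclidean_space \<Rightarrow> real"
  assumes g: "continuous_on UNIV g" "compact K" "\<And>x. x \<notin> K \<Longrightarrow> g x = 0"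
    and "K \<subseteq> \<Omega>" "\<Omega> \<in> sets lebesgue"
  shows "integrable (lebesgue_on \<Omega>) g"
    and "integral\<^sup>L (lebesgue_on \<Omega>) g = integral\<^sup>L lborel g"
proof -
  have m: "g \<in> borel_measurable lborel"
    using borel_measurable_continuous_onI[OF g(1)] by simp
  have eq: "(\<lambda>x. if x \<in> \<Omega> then g x else 0) = g"
    using assms(3,4) by (intro ext) auto
  have "integrable lebesgue g"
    using integrable_lborel_compact_support[OF g] m by (simp add: integrable_completion)
  then show "integrable (lebesgue_on \<Omega>) g"
    using Lebesgue_Measure.integrable_restrict_UNIV[OF assms(5), of g] eq by simp
  show "integral\<^sup>L (lebesgue_on \<Omega>) g = integral\<^sup>L lborel g"
    using Lebesgue_Measure.integral_restrict_UNIV[OF assms(5), of g] eq integral_completion[OF m] by simp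
qed

text \<open>The difference quotients of \<open>F\<close> have integral 0 by translation invariance, and they
  converge boundedly to the directional derivative.\<close>

lemma integral_directional_derivative_eq_0:
  fixes F :: "'a::euclidean_space \<Rightarrow> real"
  assumes der: "\<And>x. (F has_derivative F' x) (at x)"
    and cont: "continuous_on UNIV (\<lambda>x. F' x b)"
    and K: "compact K" "\<And>x. x \<notin> K \<Longrightarrow> F x = 0"
  shows "integral\<^sup>L lborel (\<lambda>x. F' x b) = 0"
proof -
  obtain r where r: "K \<subseteq> cball 0 r"
    using compact_imp_bounded[OF K(1)] by (metis bounded_pos mem_cball_0 subsetI)
  have F'0: "F' x b = 0" if "x \<notin> K" for x
  proof -
    have "(F has_derivative (\<lambda>_. 0)) (at x)"
      using has_derivative_const[of 0 "at x"]
    proof (rule has_derivative_transform_within_open)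
      show "open (- K)" using K(1) by (simp add: compact_imp_closed open_Compl)
    qed (use that K(2) in auto)
    then show ?thesis
      using has_derivative_unique[OF der[of x]] by metis
  qed
  have "compact ((\<lambda>x. F' x b) ` K)"
    using K(1) cont by (intro compact_continuous_image) (auto intro: continuous_on_subset)
  then obtain B where B: "B > 0" "\<And>x. x \<in> K \<Longrightarrow> \<bar>F' x b\<bar> \<le> B"
    using compact_imp_bounded bounded_pos by (metis imageI real_norm_def)
  then have F'B: "\<bar>F' x b\<bar> \<le> B" for x
    using F'0[of x] by (cases "x \<in> K") auto
  note line = has_real_derivative_along_line[OF der]
  have contF: "continuous_on UNIV F"
    using der by (meson continuous_at_imp_continuous_on has_derivative_continuous)
  define D where "D n x = real (Suc n) * (F (x + (1 / real (Suc n)) *\<^sub>R b) - F x)" for n x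
  have lip: "\<bar>F (x + h *\<^sub>R b) - F x\<bar> \<le> B * h" if h: "h > 0" for x h
  proof -
    obtain z where "F (x + h *\<^sub>R b) - F (x + 0 *\<^sub>R b) = (h - 0) * F' (x + z *\<^sub>R b) b"
      using MVT2[OF h, of "\<lambda>t. F (x + t *\<^sub>R b)" "\<lambda>t. F' (x + t *\<^sub>R b) b"] line by blast
    then show ?thesis
      using F'B[of "x + z *\<^sub>R b"] h
      by (simp add: abs_mult mult.commute mult_right_mono)
  qed
  \<comment> \<open>The shift has length at most \<open>norm b\<close>, so every difference quotient
    is supported in this larger ball, and \<open>lip\<close> bounds it by B there.\<close>
  define w where "w = (\<lambda>x. indicator (cball (0::'a) (r + norm b)) x *\<^sub>R B)"
  have "(\<lambda>n. integral\<^sup>L lborel (D n)) \<longlonglongrightarrow> integral\<^sup>L lborel (\<lambda>x. F' x b)"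
  proof (rule integral_dominated_convergence[where w = w])
    show "integrable lborel w"
      unfolding w_def by (intro borel_integrable_compact) auto
    show "(\<lambda>x. F' x b) \<in> borel_measurable lborel"
      using borel_measurable_continuous_onI[OF cont] by simp
    have "continuous_on UNIV (D n)" for n
      unfolding D_def
      by (intro continuous_intros continuous_on_compose2[OF contF]) auto
    then show "D n \<in> borel_measurable lborel" for n
      using borel_measurable_continuous_onI by auto
    show "AE x in lborel. (\<lambda>n. D n x) \<longlonglongrightarrow> F' x b"
    proof (rule AE_I2)
      fix x
      have "((\<lambda>h. (F (x + h *\<^sub>R b) - F x) / h) \<longlongrightarrow> F' x b) (at 0)"
        using line[of x b 0] by (simp add: DERIV_def)
      moreover have "filterlim (\<lambda>n. 1 / real (Suc n)) (at 0) sequentially"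
        using LIMSEQ_inverse_real_of_nat
        by (auto simp: filterlim_at divide_inverse)
      ultimately have "(\<lambda>n. (F (x + (1 / real (Suc n)) *\<^sub>R b) - F x) / (1 / real (Suc n)))
          \<longlonglongrightarrow> F' x b"
        by (rule filterlim_compose)
      then show "(\<lambda>n. D n x) \<longlonglongrightarrow> F' x b"
        by (simp add: D_def mult.commute)
    qed
    show "AE x in lborel. norm (D n x) \<le> w x" for n
    proof (rule AE_I2)
      fix x
      have *: "norm ((1 / real (Suc n)) *\<^sub>R b) \<le> norm b"
        by (simp add: field_simps mult_left_le)
      show "norm (D n x) \<le> w x"
      proof (cases "x \<in> cball 0 (r + norm b)")
        case True
        then show ?thesis
          using mult_left_mono[OF lip[of "1 / real (Suc n)" x], of "real (Suc n)"]
          by (simp add: D_def w_def abs_mult)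
      next
        case False
        then have "x \<notin> cball 0 r" using norm_ge_zero[of b] by (simp del: norm_ge_zero)
        moreover have "x + (1 / real (Suc n)) *\<^sub>R b \<notin> cball 0 r"
          using False * norm_diff_ineq[of x "(1 / real (Suc n)) *\<^sub>R b"] by auto
        ultimately show ?thesis
          using K(2) r False unfolding D_def w_def
          by (metis (no_types, lifting) cancel_comm_monoid_add_class.diff_cancel indicator_simps(2)
              mult_zero_right norm_zero order_refl scaleR_zero_left subsetD)
      qed
    qed
  qed
  moreover have "integral\<^sup>L lborel (D n) = 0" for n
  proof -
    define c where "c = (1 / real (Suc n)) *\<^sub>R b"
    have mF: "F \<in> borel_measurable borel"
      using borel_measurable_continuous_onI[OF contF] .
    have i: "integrable lborel F"
      using integrable_lborel_compact_support[OF contF K] by blast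
    have d: "distr lborel borel ((+) c) = (lborel :: 'a measure)"
      by (rule lborel_distr_plus)
    have "integrable lborel (\<lambda>x. F (c + x))"
      using i integrable_distr_eq[of "(+) c" lborel borel F] mF d by simp
    moreover have "integral\<^sup>L lborel (\<lambda>x. F (c + x)) = integral\<^sup>L lborel F"
      using integral_distr[of "(+) c" lborel borel F] mF d by simp
    ultimately show ?thesis
      using i unfolding D_def c_def[symmetric] by (simp add: add.commute)
  qed
  ultimately show ?thesis
    by (simp add: LIMSEQ_unique)
qed

lemma C_1_derivative:
  fixes \<phi> :: "'a::euclidean_space \<Rightarrow> real"
  assumes "C_k 1 \<phi>"
  shows "(\<phi> has_derivative (\<lambda>h. grad \<phi> x \<bullet> h)) (at x)"
    and "continuous_on UNIV (grad \<phi>)"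
proof -
  have c: "C_k (Suc 0) \<phi>" using assms by simp
  then have d: "(\<phi> has_derivative frechet_derivative \<phi> (at x)) (at x)"
    by (simp add: frechet_derivative_works)
  have "frechet_derivative \<phi> (at x) h = grad \<phi> x \<bullet> h" for h
  proof -
    have l: "linear (frechet_derivative \<phi> (at x))"
      using d by (rule has_derivative_linear)
    have "frechet_derivative \<phi> (at x) h = frechet_derivative \<phi> (at x) (\<Sum>b\<in>Basis. (h \<bullet> b) *\<^sub>R b)"
      by (simp add: euclidean_representation)
    also have "\<dots> = (\<Sum>b\<in>Basis. (h \<bullet> b) * partial_deriv b \<phi> x)"
      using l by (simp add: linear_sum linear_scale partial_deriv_def)
    finally show ?thesis
      by (simp add: grad_def inner_sum_left inner_commute[of _ h] inner_sum_right mult.commute)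
  qed
  then have "frechet_derivative \<phi> (at x) = (\<lambda>h. grad \<phi> x \<bullet> h)" by blast
  then show "(\<phi> has_derivative (\<lambda>h. grad \<phi> x \<bullet> h)) (at x)"
    using d by metis
  show "continuous_on UNIV (grad \<phi>)"
    unfolding grad_def using c by (auto intro!: continuous_intros)
qed

lemma partial_deriv_eq:
  assumes "(f has_derivative f') (at x)"
  shows "partial_deriv b f x = f' b"
  using frechet_derivative_at[OF assms] by (simp add: partial_deriv_def)

lemma test_function_derivative:
  assumes "test_function \<Omega> \<phi>"
  shows "(\<phi> has_derivative (\<lambda>h. grad \<phi> x \<bullet> h)) (at x)"
    and "partial_deriv b \<phi> x = grad \<phi> x \<bullet> b"
    and "continuous_on UNIV (grad \<phi>)"
    and "continuous_on UNIV \<phi>"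
proof -
  have *: "C_k 1 \<phi>" "C_k 0 \<phi>" using assms by (auto simp: test_function_def)
  show "(\<phi> has_derivative (\<lambda>h. grad \<phi> x \<bullet> h)) (at x)" "continuous_on UNIV (grad \<phi>)"
    using C_1_derivative[OF *(1)] by auto
  then show "partial_deriv b \<phi> x = grad \<phi> x \<bullet> b" by (simp add: partial_deriv_eq)
  show "continuous_on UNIV \<phi>" using *(2) by simp
qed

lemma test_function_support:
  assumes "test_function \<Omega> \<phi>"
  obtains K where "compact K" "K \<subseteq> \<Omega>" "\<And>x. x \<notin> K \<Longrightarrow> \<phi> x = 0" "\<And>x. x \<notin> K \<Longrightarrow> grad \<phi> x = 0"
proof -
  obtain K where K: "compact K" "K \<subseteq> \<Omega>" "\<And>x. x \<notin> K \<Longrightarrow> \<phi> x = 0"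
    using assms by (auto simp: test_function_def)
  have "grad \<phi> x = 0" if "x \<notin> K" for x
  proof -
    have "(\<phi> has_derivative (\<lambda>_. 0)) (at x)"
      using has_derivative_const[of 0 "at x"]
    proof (rule has_derivative_transform_within_open)
      show "open (- K)" using K(1) by (simp add: compact_imp_closed open_Compl)
    qed (use that K(3) in auto)
    then show ?thesis
      using partial_deriv_eq[of \<phi> "\<lambda>_. 0" x] by (simp add: grad_def)
  qed
  then show ?thesis using that K by blast
qed

text \<open>The product v \<phi> is continuously differentiable in direction b and has compact
  support inside \<Omega>. Integrals over \<Omega> are therefore integrals over the whole space,
  where the integral of its directional derivative vanishes.\<close>

lemma integration_by_parts_test_function:
  fixes v :: "'a::euclidean_space \<Rightarrow> real"
  assumes \<phi>: "test_function \<Omega> \<phi>" and \<Omega>: "\<Omega> \<in> sets lebesgue"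
    and v: "\<And>x. (v has_derivative v' x) (at x)" "continuous_on UNIV (\<lambda>x. v' x b)"
  shows "integrable (lebesgue_on \<Omega>) (\<lambda>x. v x * (grad \<phi> x \<bullet> b))"
    and "integrable (lebesgue_on \<Omega>) (\<lambda>x. v' x b * \<phi> x)"
    and "integral\<^sup>L (lebesgue_on \<Omega>) (\<lambda>x. v x * (grad \<phi> x \<bullet> b)) =
      - integral\<^sup>L (lebesgue_on \<Omega>) (\<lambda>x. v' x b * \<phi> x)"
proof -
  note \<phi>' = test_function_derivative[OF \<phi>]
  obtain K where K: "compact K" "K \<subseteq> \<Omega>" "\<And>x. x \<notin> K \<Longrightarrow> \<phi> x = 0" "\<And>x. x \<notin> K \<Longrightarrow> grad \<phi> x = 0"
    using test_function_support[OF \<phi>] by blast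
  have cv: "continuous_on UNIV v"
    using v(1) by (meson continuous_at_imp_continuous_on has_derivative_continuous)
  have c: "continuous_on UNIV (\<lambda>x. v x * (grad \<phi> x \<bullet> b))" "continuous_on UNIV (\<lambda>x. v' x b * \<phi> x)"
    using cv \<phi>'(3,4) v(2) by (auto intro!: continuous_intros)
  note 1 = compact_support_lebesgue_on[OF c(1) K(1) _ K(2) \<Omega>]
  note 2 = compact_support_lebesgue_on[OF c(2) K(1) _ K(2) \<Omega>]
  show "integrable (lebesgue_on \<Omega>) (\<lambda>x. v x * (grad \<phi> x \<bullet> b))"
    and "integrable (lebesgue_on \<Omega>) (\<lambda>x. v' x b * \<phi> x)"
    using 1(1) 2(1) K(3,4) by auto
  have "integral\<^sup>L lborel (\<lambda>x. (\<lambda>h. v x * (grad \<phi> x \<bullet> h) + v' x h * \<phi> x) b) = 0"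
  proof (rule integral_directional_derivative_eq_0[OF _ _ K(1)])
    show "((\<lambda>x. v x * \<phi> x) has_derivative (\<lambda>h. v x * (grad \<phi> x \<bullet> h) + v' x h * \<phi> x)) (at x)" for x
      by (rule has_derivative_mult[OF v(1) \<phi>'(1)])
    show "continuous_on UNIV (\<lambda>x. v x * (grad \<phi> x \<bullet> b) + v' x b * \<phi> x)"
      using c by (rule continuous_on_add)
  qed (use K(3) in auto)
  moreover have "integrable lborel (\<lambda>x. v x * (grad \<phi> x \<bullet> b))"
    "integrable lborel (\<lambda>x. v' x b * \<phi> x)"
    using integrable_lborel_compact_support[OF c(1) K(1)]
      integrable_lborel_compact_support[OF c(2) K(1)] K(3,4) by auto
  ultimately show "integral\<^sup>L (lebesgue_on \<Omega>) (\<lambda>x. v x * (grad \<phi> x \<bullet> b)) =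
      - integral\<^sup>L (lebesgue_on \<Omega>) (\<lambda>x. v' x b * \<phi> x)"
    using 1(2) 2(2) K(3,4) by simp
qed

subsection \<open>Smooth functions\<close>

text \<open>For k = 0 this is the classical smooth function that is flat at 0. The factor t^(-k)
  makes the family closed under differentiation up to linear combinations, so that smoothness
  follows from one differentiability statement valid for all k.\<close>

definition flat :: "nat \<Rightarrow> real \<Rightarrow> real" where
  "flat k t = (if 0 < t then exp (- 1 / t) / t ^ k else 0)"

lemma flat_nonneg: "0 \<le> flat k t"
  by (simp add: flat_def)

lemma flat_0_le_1: "flat 0 t \<le> 1"
  by (simp add: flat_def)

text \<open>A single term of the exponential series gives exp (1/t) >= (1/t)^(k+2) / (k+2)!. The
  quadratic decay is what makes the difference quotient at 0 tend to 0.\<close>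

lemma flat_bound: "flat k t \<le> fact (k + 2) * t\<^sup>2"
proof (cases "0 < t")
  case True
  define c :: real where "c = fact (k + 2)"
  have c: "c > 0" unfolding c_def by (rule fact_gt_zero)
  have "sum (\<lambda>n. (1 / t) ^ n /\<^sub>R fact n) {k + 2} \<le> (\<Sum>n. (1 / t) ^ n /\<^sub>R fact n)"
    using True by (intro sum_le_suminf summable_exp_generic) auto
  then have "(1 / t) ^ (k + 2) / c \<le> exp (1 / t)"
    unfolding exp_def c_def by (simp add: divide_inverse mult.commute del: fact_Suc power_Suc)
  then have "1 / (t ^ (k + 2) * c) \<le> exp (1 / t)"
    by (simp add: power_one_over del: power_Suc)
  then have "1 \<le> exp (1 / t) * (t ^ (k + 2) * c)"
    using True c by (subst (asm) pos_divide_le_eq) auto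
  then have "1 / exp (1 / t) \<le> t ^ (k + 2) * c"
    by (subst pos_divide_le_eq) (auto simp: mult_ac)
  also have "t ^ (k + 2) * c = c * t\<^sup>2 * t ^ k"
    by (simp add: power_add power2_eq_square)
  finally have "exp (- 1 / t) / t ^ k \<le> c * t\<^sup>2"
    using True by (subst pos_divide_le_eq) (auto simp: exp_minus inverse_eq_divide)
  then show ?thesis
    using True by (simp add: flat_def c_def)
qed (simp add: flat_def)

lemma DERIV_flat:
  "(flat k has_real_derivative flat (k + 2) t - real k * flat (k + 1) t) (at t)"
proof -
  consider "t > 0" | "t < 0" | "t = 0" by linarith
  then show ?thesis
  proof cases
    case 1
    have "((\<lambda>t. exp (- 1 / t) / t ^ k) has_real_derivative
        flat (k + 2) t - real k * flat (k + 1) t) (at t)"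
    proof -
      have "((\<lambda>t. exp (- 1 / t)) has_real_derivative exp (- 1 / t) / t\<^sup>2) (at t)"
        using 1 by (auto intro!: derivative_eq_intros simp: power2_eq_square)
      moreover have "((\<lambda>t. t ^ k) has_real_derivative real k * t ^ k / t) (at t)"
        using DERIV_pow[of k t] 1 by (cases k) auto
      ultimately have D: "((\<lambda>t. exp (- 1 / t) / t ^ k) has_real_derivative
          (exp (- 1 / t) / t\<^sup>2 * t ^ k - exp (- 1 / t) * (real k * t ^ k / t)) / (t ^ k * t ^ k)) (at t)"
        using 1 by (intro DERIV_divide) auto
      have *: "(e / t\<^sup>2 * y - e * (r * y / t)) / (y * y) = e / (y * t\<^sup>2) - r * (e / (y * t))"
        if "y \<noteq> 0" for e y r :: real
        using 1 that by (simp add: field_simps power2_eq_square)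
      have "(exp (- 1 / t) / t\<^sup>2 * t ^ k - exp (- 1 / t) * (real k * t ^ k / t)) / (t ^ k * t ^ k)
          = flat (k + 2) t - real k * flat (k + 1) t"
        using 1 by (subst *) (simp_all only: flat_def power_add power_one_right if_True
            power_eq_0_iff, simp)
      with D show ?thesis by simp
    qed
    then show ?thesis
      by (rule has_field_derivative_transform_within_open[of _ _ _ "{0<..}"])
        (use 1 in \<open>auto simp: flat_def\<close>)
  next
    case 2
    have "((\<lambda>t. 0) has_real_derivative 0) (at t)" by simp
    then have "(flat k has_real_derivative 0) (at t)"
      by (rule has_field_derivative_transform_within_open[of _ _ _ "{..<0}"])
        (use 2 in \<open>auto simp: flat_def\<close>)
    then show ?thesis using 2 by (simp add: flat_def)
  next
    case 3
    have "((\<lambda>h. (flat k h - flat k 0) / (h - 0)) \<longlongrightarrow> 0) (at 0)"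
    proof (rule Lim_null_comparison)
      show "\<forall>\<^sub>F h in at 0. norm ((flat k h - flat k 0) / (h - 0)) \<le> fact (k + 2) * \<bar>h\<bar>"
      proof (rule eventually_at_filter[THEN iffD2], rule always_eventually, intro allI impI)
        fix h :: real assume h: "h \<noteq> 0"
        have "flat k h \<le> fact (k + 2) * \<bar>h\<bar> * \<bar>h\<bar>"
          using flat_bound[of k h] by (simp only: power2_eq_square mult.assoc abs_mult_self_eq)
        then have "flat k h / \<bar>h\<bar> \<le> fact (k + 2) * \<bar>h\<bar>"
          using h by (subst pos_divide_le_eq) auto
        moreover have "flat k 0 = 0" by (simp add: flat_def)
        ultimately show "norm ((flat k h - flat k 0) / (h - 0)) \<le> fact (k + 2) * \<bar>h\<bar>"
          by (simp only: real_norm_def abs_divide diff_zero abs_of_nonneg[OF flat_nonneg])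
      qed
      show "((\<lambda>h. fact (k + 2) * \<bar>h\<bar>) \<longlongrightarrow> 0) (at (0::real))"
        by (auto intro!: tendsto_eq_intros)
    qed
    then show ?thesis
      using 3 by (simp add: has_field_derivative_iff flat_def)
  qed
qed

text \<open>This algebra is closed under partial derivatives, so its members are smooth.\<close>

inductive radially_smooth :: "('a::euclidean_space \<Rightarrow> real) \<Rightarrow> bool" where
  const: "radially_smooth (\<lambda>x. c)"
| coord: "radially_smooth (\<lambda>x. x \<bullet> b)"
| flat: "radially_smooth (\<lambda>x. flat k (c + d * (x \<bullet> x)))"
| add: "radially_smooth f \<Longrightarrow> radially_smooth g \<Longrightarrow> radially_smooth (\<lambda>x. f x + g x)"
| mult: "radially_smooth f \<Longrightarrow> radially_smooth g \<Longrightarrow> radially_smooth (\<lambda>x. f x * g x)"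
| antiderivative: "radially_smooth (\<lambda>x. h (x \<bullet> x)) \<Longrightarrow>
    (\<And>t. 0 \<le> t \<Longrightarrow> (H has_real_derivative h t) (at t)) \<Longrightarrow> radially_smooth (\<lambda>x. H (x \<bullet> x))"

lemma has_derivative_radial:
  fixes x :: "'a::real_inner"
  assumes "(H has_real_derivative h (x \<bullet> x)) (at (x \<bullet> x))"
  shows "((\<lambda>x. H (x \<bullet> x)) has_derivative (\<lambda>y. h (x \<bullet> x) * (2 * (x \<bullet> y)))) (at x)"
proof -
  have "((\<lambda>x. x \<bullet> x) has_derivative (\<lambda>y. 2 * (x \<bullet> y))) (at x)"
    by (auto intro!: derivative_eq_intros simp: inner_commute)
  from has_derivative_compose[OF this, of H "(*) (h (x \<bullet> x))"] assms
  show ?thesis by (simp add: has_field_derivative_def)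
qed

lemma radially_smooth_derivative:
  fixes f :: "'a::euclidean_space \<Rightarrow> real"
  assumes "radially_smooth f"
  shows "\<exists>f'. (\<forall>x. (f has_derivative f' x) (at x)) \<and> (\<forall>b. radially_smooth (\<lambda>x. f' x b))"
  using assms
proof induction
  case (const c)
  then show ?case
    by (intro exI[of _ "\<lambda>_ _. 0"]) (auto intro: radially_smooth.const)
next
  case (coord b)
  then show ?case
    by (intro exI[of _ "\<lambda>_ y. y \<bullet> b"])
      (auto intro!: radially_smooth.const derivative_eq_intros)
next
  case (flat k c d)
  define h where "h t = (flat (k + 2) (c + d * t) - real k * flat (k + 1) (c + d * t)) * d" for t
  have H: "((\<lambda>t. flat k (c + d * t)) has_real_derivative h t) (at t)" for t
    unfolding h_def by (rule DERIV_chain2[OF DERIV_flat]) (auto intro!: derivative_eq_intros)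
  have *: "(\<lambda>x. h (x \<bullet> x) * (2 * (x \<bullet> b))) = (\<lambda>x. (flat (k + 2) (c + d * (x \<bullet> x)) +
      (- real k) * flat (k + 1) (c + d * (x \<bullet> x))) * ((2 * d) * (x \<bullet> b)))" for b :: 'a
    by (auto simp: h_def)
  show ?case
  proof (intro exI conjI allI)
    show "((\<lambda>x. flat k (c + d * (x \<bullet> x))) has_derivative
        (\<lambda>y. h (x \<bullet> x) * (2 * (x \<bullet> y)))) (at x)" for x :: 'a
      by (rule has_derivative_radial[where H = "\<lambda>t. flat k (c + d * t)" and h = h, OF H])
    show "radially_smooth (\<lambda>x. h (x \<bullet> x) * (2 * (x \<bullet> b)))" for b :: 'a
      unfolding * by (intro radially_smooth.intros)
  qed
next
  case (add f g)
  then obtain f' g' where "\<And>x. (f has_derivative f' x) (at x)" "\<And>b. radially_smooth (\<lambda>x. f' x b)"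
    "\<And>x. (g has_derivative g' x) (at x)" "\<And>b. radially_smooth (\<lambda>x. g' x b)" by blast
  then show ?case
    by (intro exI[of _ "\<lambda>x y. f' x y + g' x y"])
      (auto intro!: radially_smooth.add has_derivative_add)
next
  case (mult f g)
  then obtain f' g' where "\<And>x. (f has_derivative f' x) (at x)" "\<And>b. radially_smooth (\<lambda>x. f' x b)"
    "\<And>x. (g has_derivative g' x) (at x)" "\<And>b. radially_smooth (\<lambda>x. g' x b)" by blast
  with mult.hyps show ?case
    by (intro exI[of _ "\<lambda>x y. f x * g' x y + f' x y * g x"])
      (auto intro!: radially_smooth.add radially_smooth.mult has_derivative_mult)
next
  \<comment> \<open>Differentiating H brings back h, which lies in the algebra by the premise of the
    rule.\<close>
  case (antiderivative h H)
  have "radially_smooth (\<lambda>x. h (x \<bullet> x) * (2 * (x \<bullet> b)))" for b :: 'a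
    using antiderivative.hyps(1) by (intro radially_smooth.mult radially_smooth.const radially_smooth.coord)
  then show ?case
    using antiderivative.hyps(2)
    by (intro exI[of _ "\<lambda>x y. h (x \<bullet> x) * (2 * (x \<bullet> y))"])
      (auto intro!: has_derivative_radial)
qed

lemma radially_smooth_C_k:
  assumes "radially_smooth f"
  shows "C_k k f"
  using assms
proof (induction k arbitrary: f)
  case 0
  then obtain f' where "\<And>x. (f has_derivative f' x) (at x)"
    using radially_smooth_derivative by blast
  then show ?case
    by (auto intro!: continuous_at_imp_continuous_on dest: has_derivative_continuous)
next
  case (Suc k)
  then obtain f' where f': "\<And>x. (f has_derivative f' x) (at x)"
    "\<And>b. radially_smooth (\<lambda>x. f' x b)"
    using radially_smooth_derivative by blast
  have "partial_deriv b f = (\<lambda>x. f' x b)" for b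
    using partial_deriv_eq[OF f'(1)] by auto
  then show ?case
    using Suc.IH f' by (auto simp: differentiable_def)
qed

lemma radially_smooth_sum:
  "(\<And>i. i \<in> I \<Longrightarrow> radially_smooth (f i)) \<Longrightarrow> radially_smooth (\<lambda>x. \<Sum>i\<in>I. f i x)"
  by (induction I rule: infinite_finite_induct) (auto intro: radially_smooth.intros)

text \<open>Serves for the polynomials delivered by the Stone-Weierstrass theorem. The generator
  \<open>coord\<close> is linear in x, hence |x|^2 enters as the sum of the squared
  coordinates.\<close>

lemma radially_smooth_polynomial:
  assumes "real_polynomial_function P"
  shows "radially_smooth (\<lambda>x::'a::euclidean_space. P (x \<bullet> x))"
  using assms
proof induction
  case (linear P)
  have "(\<lambda>x::'a. P (x \<bullet> x)) = (\<lambda>x. (\<Sum>b\<in>Basis. (x \<bullet> b) * (x \<bullet> b)) * P 1)"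
  proof
    fix x :: 'a
    have "P ((x \<bullet> x) *\<^sub>R 1) = (x \<bullet> x) *\<^sub>R P 1"
      using linear by (intro linear_scale) (rule bounded_linear.linear)
    then show "P (x \<bullet> x) = (\<Sum>b\<in>Basis. (x \<bullet> b) * (x \<bullet> b)) * P 1"
      by (simp add: euclidean_inner[of x x])
  qed
  then show ?case
    by (simp only:) (intro radially_smooth.intros radially_smooth_sum)
qed (auto intro: radially_smooth.intros)

subsection \<open>Weak formulation\<close>

lemma test_function_in_Lp:
  assumes \<phi>: "test_function \<Omega> \<phi>" and "\<Omega> \<in> lmeasurable" "0 \<le> p"
  shows "in_Lp p \<Omega> \<phi>" "in_Lp p \<Omega> (grad \<phi>)"
proof -
  note \<phi>' = test_function_derivative[OF \<phi>]
  obtain K where K: "compact K" "\<And>x. x \<notin> K \<Longrightarrow> \<phi> x = 0" "\<And>x. x \<notin> K \<Longrightarrow> grad \<phi> x = 0"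
    using test_function_support[OF \<phi>] by metis
  have bd: "\<exists>B. \<forall>x. norm (g x) \<le> B"
    if "continuous_on UNIV g" "\<And>x. x \<notin> K \<Longrightarrow> g x = 0" for g :: "'a \<Rightarrow> 'c::real_normed_vector"
  proof -
    have "compact (g ` K)"
      using K(1) that(1) by (intro compact_continuous_image) (auto intro: continuous_on_subset)
    then obtain B where "B > 0" "\<And>x. x \<in> K \<Longrightarrow> norm (g x) \<le> B"
      using compact_imp_bounded bounded_pos by (metis imageI)
    then show ?thesis using that(2) by (intro exI[of _ B]) (metis less_le norm_zero)
  qed
  show "in_Lp p \<Omega> \<phi>" "in_Lp p \<Omega> (grad \<phi>)"
    using bd[OF \<phi>'(4) K(2)] bd[OF \<phi>'(3) K(3)] \<phi>'(3,4) assms(2,3)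
    by (auto intro!: in_Lp_bounded borel_measurable_lebesgue_on_continuous)
qed

lemma integrable_bounded_inner:
  fixes V g :: "'a::euclidean_space \<Rightarrow> 'b::euclidean_space"
  assumes V: "V \<in> borel_measurable (lebesgue_on \<Omega>)" "\<And>x. x \<in> \<Omega> \<Longrightarrow> norm (V x) \<le> B"
    and g: "integrable (lebesgue_on \<Omega>) g"
  shows "integrable (lebesgue_on \<Omega>) (\<lambda>x. V x \<bullet> g x)"
    and "\<bar>integral\<^sup>L (lebesgue_on \<Omega>) (\<lambda>x. V x \<bullet> g x)\<bar> \<le>
      B * integral\<^sup>L (lebesgue_on \<Omega>) (\<lambda>x. norm (g x))"
proof -
  have *: "\<bar>V x \<bullet> g x\<bar> \<le> B * norm (g x)" if "x \<in> \<Omega>" for x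
    using Cauchy_Schwarz_ineq2[of "V x" "g x"] V(2)[OF that]
    by (meson mult_right_mono norm_ge_zero order_trans)
  have i: "integrable (lebesgue_on \<Omega>) (\<lambda>x. B * norm (g x))"
    using g by simp
  show int: "integrable (lebesgue_on \<Omega>) (\<lambda>x. V x \<bullet> g x)"
    using i
  proof (rule Bochner_Integration.integrable_bound)
    show "(\<lambda>x. V x \<bullet> g x) \<in> borel_measurable (lebesgue_on \<Omega>)"
      using V(1) g by (intro borel_measurable_inner) auto
    show "AE x in lebesgue_on \<Omega>. norm (V x \<bullet> g x) \<le> norm (B * norm (g x))"
      using * by (auto intro!: AE_I2 order_trans[OF * abs_ge_self])
  qed
  have "\<bar>integral\<^sup>L (lebesgue_on \<Omega>) (\<lambda>x. V x \<bullet> g x)\<bar> \<le>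
      integral\<^sup>L (lebesgue_on \<Omega>) (\<lambda>x. \<bar>V x \<bullet> g x\<bar>)"
    using integral_norm_bound[of "lebesgue_on \<Omega>" "\<lambda>x. V x \<bullet> g x"] by simp
  also have "\<dots> \<le> integral\<^sup>L (lebesgue_on \<Omega>) (\<lambda>x. B * norm (g x))"
    using int i * by (intro integral_mono) auto
  finally show "\<bar>integral\<^sup>L (lebesgue_on \<Omega>) (\<lambda>x. V x \<bullet> g x)\<bar> \<le>
      B * integral\<^sup>L (lebesgue_on \<Omega>) (\<lambda>x. norm (g x))"
    by simp
qed

text \<open>Convergence in L^p implies convergence in L^1 on a set of finite measure, and pairing
  with a bounded V is continuous in L^1. It is applied both to gradients and, with the inner product
  of the reals, to the functions themselves.\<close>

lemma integral_bounded_inner_Lp_tendsto: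
  fixes V g :: "'a::euclidean_space \<Rightarrow> 'b::euclidean_space"
  assumes \<Omega>: "\<Omega> \<in> lmeasurable" and p: "1 \<le> p"
    and V: "V \<in> borel_measurable (lebesgue_on \<Omega>)" "\<And>x. x \<in> \<Omega> \<Longrightarrow> norm (V x) \<le> B"
    and g: "in_Lp p \<Omega> g" and gn: "\<And>n. in_Lp p \<Omega> (gn n)"
    and lim: "(\<lambda>n. Lp_norm p \<Omega> (\<lambda>x. g x - gn n x)) \<longlonglongrightarrow> 0"
  shows "(\<lambda>n. integral\<^sup>L (lebesgue_on \<Omega>) (\<lambda>x. V x \<bullet> gn n x)) \<longlonglongrightarrow>
    integral\<^sup>L (lebesgue_on \<Omega>) (\<lambda>x. V x \<bullet> g x)"
proof -
  have d: "in_Lp p \<Omega> (\<lambda>x. g x - gn n x)" for n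
    using in_Lp_diff[OF g gn] p by simp
  note int = in_Lp_imp_integrable[OF \<Omega> _ p]
  have "(\<lambda>n. B * integral\<^sup>L (lebesgue_on \<Omega>) (\<lambda>x. norm (g x - gn n x))) \<longlonglongrightarrow> 0"
    using tendsto_mult_right_zero[OF Lp_norm_tendsto_0_imp_L1[OF \<Omega> p d lim]] .
  moreover have "\<bar>integral\<^sup>L (lebesgue_on \<Omega>) (\<lambda>x. V x \<bullet> gn n x) -
      integral\<^sup>L (lebesgue_on \<Omega>) (\<lambda>x. V x \<bullet> g x)\<bar> \<le>
      B * integral\<^sup>L (lebesgue_on \<Omega>) (\<lambda>x. norm (g x - gn n x))" for n
  proof -
    have "integral\<^sup>L (lebesgue_on \<Omega>) (\<lambda>x. V x \<bullet> (g x - gn n x)) =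
        integral\<^sup>L (lebesgue_on \<Omega>) (\<lambda>x. V x \<bullet> g x) - integral\<^sup>L (lebesgue_on \<Omega>) (\<lambda>x. V x \<bullet> gn n x)"
      using integrable_bounded_inner(1)[OF V int[OF g]] integrable_bounded_inner(1)[OF V int[OF gn]]
      by (simp add: inner_diff_right)
    then show ?thesis
      using integrable_bounded_inner(2)[OF V int[OF d], of n] by simp
  qed
  ultimately show ?thesis
    by - (rule LIM_zero_cancel, rule Lim_null_comparison, rule always_eventually, auto)
qed

text \<open>V and f stand for the two nonlinear expressions on \<Omega>. Their bounds make both
  sides of the identity continuous along the approximating sequence that \<open>W1p_zero\<close>
  provides for \<phi> and D\<phi>, and also yield the integrability clauses of
  \<open>weak_solution\<close>.\<close>

lemma weak_solutionI:
  fixes u :: "'a::euclidean_space \<Rightarrow> real"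
  assumes \<Omega>: "\<Omega> \<in> lmeasurable" and p: "1 \<le> p" and u: "W1p_zero p \<Omega> u Du"
    and V: "V \<in> borel_measurable (lebesgue_on \<Omega>)" "\<And>x. x \<in> \<Omega> \<Longrightarrow> norm (V x) \<le> B"
      "\<And>x. x \<in> \<Omega> \<Longrightarrow> V x = norm (Du x) powr (p - 2) *\<^sub>R Du x"
    and f: "f \<in> borel_measurable (lebesgue_on \<Omega>)" "\<And>x. x \<in> \<Omega> \<Longrightarrow> norm (f x) \<le> A"
      "\<And>x. x \<in> \<Omega> \<Longrightarrow> f x = w x * \<bar>u x\<bar> powr (p - 2) * u x"
    and eq: "\<And>\<phi>. test_function \<Omega> \<phi> \<Longrightarrow>
      integral\<^sup>L (lebesgue_on \<Omega>) (\<lambda>x. V x \<bullet> grad \<phi> x) = integral\<^sup>L (lebesgue_on \<Omega>) (\<lambda>x. f x * \<phi> x)"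
  shows "weak_solution p \<Omega> w u"
  unfolding weak_solution_def
proof (intro exI[of _ Du] conjI allI impI)
  fix \<phi> D\<phi> assume "W1p_zero p \<Omega> \<phi> D\<phi>"
  then obtain \<phi>n where \<phi>: "in_Lp p \<Omega> \<phi>" "in_Lp p \<Omega> D\<phi>" and t: "\<And>n. test_function \<Omega> (\<phi>n n)"
    and l: "(\<lambda>n. Lp_norm p \<Omega> (\<lambda>x. \<phi> x - \<phi>n n x)) \<longlonglongrightarrow> 0"
      "(\<lambda>n. Lp_norm p \<Omega> (\<lambda>x. D\<phi> x - grad (\<phi>n n) x)) \<longlonglongrightarrow> 0"
    by (auto simp: W1p_zero_def W1p_def)
  have tL: "in_Lp p \<Omega> (\<phi>n n)" "in_Lp p \<Omega> (grad (\<phi>n n))" for n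
    using test_function_in_Lp[OF t \<Omega>] p by auto
  note int = in_Lp_imp_integrable[OF \<Omega> _ p]
  have c1: "integrable (lebesgue_on \<Omega>) (\<lambda>x. (norm (Du x) powr (p - 2) *\<^sub>R Du x) \<bullet> D\<phi> x) \<longleftrightarrow>
      integrable (lebesgue_on \<Omega>) (\<lambda>x. V x \<bullet> D\<phi> x)"
    using V(3) by (intro Bochner_Integration.integrable_cong) auto
  have c2: "integrable (lebesgue_on \<Omega>) (\<lambda>x. w x * \<bar>u x\<bar> powr (p - 2) * u x * \<phi> x) \<longleftrightarrow>
      integrable (lebesgue_on \<Omega>) (\<lambda>x. f x \<bullet> \<phi> x)"
    using f(3) by (intro Bochner_Integration.integrable_cong) auto
  have c3: "integral\<^sup>L (lebesgue_on \<Omega>) (\<lambda>x. (norm (Du x) powr (p - 2) *\<^sub>R Du x) \<bullet> D\<phi> x) =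
      integral\<^sup>L (lebesgue_on \<Omega>) (\<lambda>x. V x \<bullet> D\<phi> x)"
    using V(3) by (intro Bochner_Integration.integral_cong) auto
  have c4: "integral\<^sup>L (lebesgue_on \<Omega>) (\<lambda>x. w x * \<bar>u x\<bar> powr (p - 2) * u x * \<phi> x) =
      integral\<^sup>L (lebesgue_on \<Omega>) (\<lambda>x. f x \<bullet> \<phi> x)"
    using f(3) by (intro Bochner_Integration.integral_cong) auto
  show "integrable (lebesgue_on \<Omega>) (\<lambda>x. (norm (Du x) powr (p - 2) *\<^sub>R Du x) \<bullet> D\<phi> x)"
    unfolding c1 by (rule integrable_bounded_inner(1)[OF V(1,2) int[OF \<phi>(2)]])
  show "integrable (lebesgue_on \<Omega>) (\<lambda>x. w x * \<bar>u x\<bar> powr (p - 2) * u x * \<phi> x)"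
    unfolding c2 by (rule integrable_bounded_inner(1)[OF f(1,2) int[OF \<phi>(1)]])
  have "(\<lambda>n. integral\<^sup>L (lebesgue_on \<Omega>) (\<lambda>x. V x \<bullet> grad (\<phi>n n) x)) \<longlonglongrightarrow>
      integral\<^sup>L (lebesgue_on \<Omega>) (\<lambda>x. V x \<bullet> D\<phi> x)"
    by (rule integral_bounded_inner_Lp_tendsto[OF \<Omega> p V(1,2) \<phi>(2) tL(2) l(2)])
  moreover have "(\<lambda>n. integral\<^sup>L (lebesgue_on \<Omega>) (\<lambda>x. f x \<bullet> \<phi>n n x)) \<longlonglongrightarrow>
      integral\<^sup>L (lebesgue_on \<Omega>) (\<lambda>x. f x \<bullet> \<phi> x)"
    by (rule integral_bounded_inner_Lp_tendsto[OF \<Omega> p f(1,2) \<phi>(1) tL(1) l(1)])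
  ultimately show "integral\<^sup>L (lebesgue_on \<Omega>) (\<lambda>x. (norm (Du x) powr (p - 2) *\<^sub>R Du x) \<bullet> D\<phi> x) =
      integral\<^sup>L (lebesgue_on \<Omega>) (\<lambda>x. w x * \<bar>u x\<bar> powr (p - 2) * u x * \<phi> x)"
    unfolding c3 c4 using eq[OF t] by (simp add: LIMSEQ_unique)
qed fact

subsection \<open>Radial functions vanishing on the boundary of a ball\<close>

text \<open>Integration starts at -1 so that t = 0 is an interior point and the derivative there is
  two-sided, as the chain rule with |x|^2 requires at the origin.\<close>

lemma antiderivative_nonneg:
  fixes q :: "real \<Rightarrow> real"
  assumes q: "continuous_on UNIV q"
  obtains U where "\<And>t. 0 \<le> t \<Longrightarrow> (U has_real_derivative q t) (at t)" "U c = 0"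
proof -
  define U where "U t = integral {-1..t} q - integral {-1..c} q" for t
  have "(U has_real_derivative q t) (at t)" if t: "0 \<le> t" for t
  proof -
    have "((\<lambda>x. integral {-1..x} q) has_real_derivative q t) (at t within {-1..t + 1})"
      using t by (intro integral_has_real_derivative continuous_on_subset[OF q]) auto
    then have "((\<lambda>x. integral {-1..x} q) has_real_derivative q t) (at t)"
      using t by (simp add: at_within_Icc_at)
    then show ?thesis
      unfolding U_def by (auto intro!: derivative_eq_intros)
  qed
  moreover have "U c = 0" by (simp add: U_def)
  ultimately show ?thesis by (rule that)
qed

text \<open>Since H n vanishes at r, its value at t is minus the integral of h n over (t, r), and
  dominated convergence applies. Pointwise convergence is asked only below r, because in the
  application the cut-off forces h n at r to differ from its limit; hence the open
  intervals.\<close>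

lemma antiderivative_bounded_tendsto_0:
  fixes h :: "nat \<Rightarrow> real \<Rightarrow> real"
  assumes H: "\<And>n t. 0 \<le> t \<Longrightarrow> (H n has_real_derivative h n t) (at t)" "\<And>n. H n r = 0"
    and B: "\<And>n t. 0 \<le> t \<Longrightarrow> t \<le> r \<Longrightarrow> \<bar>h n t\<bar> \<le> B"
    and lim: "\<And>t. 0 \<le> t \<Longrightarrow> t < r \<Longrightarrow> (\<lambda>n. h n t) \<longlonglongrightarrow> 0"
    and t: "0 \<le> t" "t \<le> r"
  shows "(\<lambda>n. H n t) \<longlonglongrightarrow> 0" and "\<bar>H n t\<bar> \<le> r * B"
proof -
  have I: "(h n has_integral - H n t) {t..r}" for n
    using fundamental_theorem_of_calculus[of t r "H n" "h n"] H t
    by (force simp: has_real_derivative_iff_has_vector_derivative[symmetric]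
        intro: has_field_derivative_at_within)
  have "(\<lambda>n. integral {t<..<r} (h n)) \<longlonglongrightarrow> integral {t<..<r} (\<lambda>_. 0)"
  proof (rule dominated_convergence[where h = "\<lambda>_. B"])
    show "\<And>n. h n integrable_on {t<..<r}"
      using I by (auto simp: integrable_on_open_interval_real has_integral_iff)
    show "(\<lambda>_. B) integrable_on {t<..<r}"
      by (auto simp: integrable_on_open_interval_real)
  qed (use B lim t in auto)
  moreover have "integral {t<..<r} (h n) = - H n t" for n
    using I[of n] integral_open_interval_real[of t r "h n"] by (auto simp: has_integral_iff)
  ultimately show "(\<lambda>n. H n t) \<longlonglongrightarrow> 0"
    using tendsto_minus[of "\<lambda>n. - H n t"] by fastforce
  have B0: "0 \<le> B" using B[of t n] t by linarith
  have "norm (- H n t) \<le> B * (r - t)"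
    using has_integral_bound_real[OF B0 _ I[of n], of "{}"] B t by auto
  also have "\<dots> \<le> r * B"
    using B0 t by (simp add: mult.commute mult_left_mono)
  finally show "\<bar>H n t\<bar> \<le> r * B" by simp
qed

text \<open>The approximants are built from the derivative: q is approximated by polynomials on
  [0, R^2], these are multiplied by a smooth cut-off, and the product is integrated inward from R^2.
  The result is constant, hence zero, near the boundary, and it is smooth. Cutting off u itself
  would bring in the gradient of the cut-off, which blows up near the boundary.\<close>

lemma W1p_zero_radial:
  fixes p R :: real and q U :: "real \<Rightarrow> real"
  assumes p: "1 \<le> p" and R: "0 < R" and q: "continuous_on UNIV q"
    and U: "\<And>t. 0 \<le> t \<Longrightarrow> (U has_real_derivative q t) (at t)" "U (R\<^sup>2) = 0"
  shows "W1p_zero p (ball (0::'a::euclidean_space) R)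
    (\<lambda>x. U (x \<bullet> x)) (\<lambda>x. (2 * q (x \<bullet> x)) *\<^sub>R x)"
proof -
  define \<Omega> where "\<Omega> = ball (0::'a) R"
  define r where "r = R\<^sup>2"
  define u where "u x = U (x \<bullet> x)" for x :: 'a
  define Du where "Du x = (2 * q (x \<bullet> x)) *\<^sub>R x" for x :: 'a
  have \<Omega>: "\<Omega> \<in> lmeasurable" by (simp add: \<Omega>_def)
  have in\<Omega>: "x \<bullet> x < r" if "x \<in> \<Omega>" for x
    using that R by (simp add: \<Omega>_def r_def norm_lt_square flip: power2_norm_eq_inner)
  have r: "0 < r" using R by (simp add: r_def)
  have du: "(u has_derivative (\<lambda>y. Du x \<bullet> y)) (at x)" for x
    using has_derivative_radial[where H = U and h = q and x = x, OF U(1)] unfolding u_def Du_def by (simp add: mult_ac)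
  have cu: "continuous_on UNIV u"
    using du by (meson continuous_at_imp_continuous_on has_derivative_continuous)
  have cDu: "continuous_on UNIV Du"
    unfolding Du_def by (intro continuous_intros continuous_on_compose2[OF q]) auto
  obtain Q where Q: "\<And>t. 0 \<le> t \<Longrightarrow> t \<le> r \<Longrightarrow> \<bar>q t\<bar> \<le> Q"
  proof -
    have "compact (q ` {0..r})"
      by (intro compact_continuous_image continuous_on_subset[OF q]) auto
    then show ?thesis
      using that compact_imp_bounded bounded_iff by (metis atLeastAtMost_iff imageI real_norm_def)
  qed
  have "\<exists>P. real_polynomial_function P \<and> (\<forall>t\<in>{0..r}. \<bar>q t - P t\<bar> < 1 / real (Suc n))" for n
    by (rule Stone_Weierstrass_real_polynomial_function[of "{0..r}" q "1 / real (Suc n)"])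
      (auto intro: continuous_on_subset[OF q])
  then obtain P where P: "\<And>n. real_polynomial_function (P n)"
    "\<And>n t. 0 \<le> t \<Longrightarrow> t \<le> r \<Longrightarrow> \<bar>q t - P n t\<bar> < 1 / real (Suc n)"
    by (metis atLeastAtMost_iff)
  define c where "c n = real (Suc n)" for n
  have c: "c n \<ge> 1" for n by (simp add: c_def)
  \<comment> \<open>The argument is c n (r - t) - 1, in the affine form of the rule
    \<open>flat\<close>. It is positive exactly for t < r - 1 / c n and tends to infinity for each
    fixed t < r, so the cut-off tends to exp 0 = 1 there.\<close>
  define \<eta> where "\<eta> n t = flat 0 ((c n * r - 1) + (- c n) * t)" for n t
  define \<psi> where "\<psi> n t = P n t * \<eta> n t" for n t
  have \<psi>0: "\<psi> n t = 0" if "r - 1 / c n \<le> t" for n t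
  proof -
    have "c n * r - 1 \<le> c n * t"
      using mult_left_mono[OF that, of "c n"] c[of n] by (simp add: right_diff_distrib)
    then show ?thesis by (simp add: \<psi>_def \<eta>_def flat_def)
  qed
  have c\<psi>: "continuous_on UNIV (\<psi> n)" for n
  proof -
    have "continuous_on UNIV (flat 0)"
      using DERIV_flat DERIV_isCont by (blast intro: continuous_at_imp_continuous_on)
    moreover have "continuous_on UNIV (P n)"
      using P(1) by (simp add: continuous_on_polymonial_function real_polynomial_function_eq)
    moreover have "continuous_on UNIV (\<eta> n)"
      unfolding \<eta>_def
      by (rule continuous_on_compose2[OF \<open>continuous_on UNIV (flat 0)\<close>])
        (auto intro!: continuous_intros)
    ultimately show ?thesis
      unfolding \<psi>_def by (auto intro!: continuous_intros)
  qed
  have "\<exists>H. (\<forall>t\<ge>0. (H has_real_derivative \<psi> n t) (at t)) \<and> H r = 0" for n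
    using antiderivative_nonneg[OF c\<psi>] by metis
  then obtain H where H: "\<And>n t. 0 \<le> t \<Longrightarrow> (H n has_real_derivative \<psi> n t) (at t)" "\<And>n. H n r = 0"
    by metis
  \<comment> \<open>The integrand vanishes from r - 1 / c n on, so H n keeps its value at r. The
    maximum with 0 stays in the range where H n is known to be differentiable, since r - 1 / c n may
    be negative.\<close>
  have H0: "H n t = 0" if "max 0 (r - 1 / c n) \<le> t" for n t
  proof (cases "t = r")
    case False
    then consider "t < r" | "r < t" by linarith
    then show ?thesis
    proof cases
      case 1
      have "\<exists>z>t. z < r \<and> H n r - H n t = (r - t) * \<psi> n z"
        by (rule MVT2[OF 1], rule H(1)) (use that in linarith)
      then obtain z where z: "t < z" "z < r" "H n r - H n t = (r - t) * \<psi> n z" by blast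
      have "\<psi> n z = 0" using z that by (intro \<psi>0) auto
      then show ?thesis using z(3) H(2) by simp
    next
      case 2
      have "\<exists>z>r. z < t \<and> H n t - H n r = (t - r) * \<psi> n z"
        by (rule MVT2[OF 2], rule H(1)) (use r in linarith)
      then obtain z where z: "r < z" "z < t" "H n t - H n r = (t - r) * \<psi> n z" by blast
      have "1 / c n \<ge> 0" using c[of n] by simp
      then have "\<psi> n z = 0" using z by (intro \<psi>0) linarith
      then show ?thesis using z(3) H(2) by simp
    qed
  qed (simp add: H(2))
  define \<phi> where "\<phi> n x = H n (x \<bullet> x)" for n and x :: 'a
  have d\<phi>: "(\<phi> n has_derivative (\<lambda>y. ((2 * \<psi> n (x \<bullet> x)) *\<^sub>R x) \<bullet> y)) (at x)" for n x
    using has_derivative_radial[where H = "H n" and h = "\<psi> n" and x = x, OF H(1)] unfolding \<phi>_def by (simp add: mult_ac)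
  have s\<phi>: "radially_smooth (\<phi> n)" for n
    unfolding \<phi>_def
  proof (rule radially_smooth.antiderivative[OF _ H(1)])
    show "radially_smooth (\<lambda>x. \<psi> n (x \<bullet> x))"
      unfolding \<psi>_def \<eta>_def
      by (intro radially_smooth.mult radially_smooth.flat radially_smooth_polynomial P)
  qed
  have t\<phi>: "test_function \<Omega> (\<phi> n)" for n
    unfolding test_function_def
  proof (intro conjI allI)
    show "C_k k (\<phi> n)" for k by (rule radially_smooth_C_k[OF s\<phi>])
    define \<rho> where "\<rho> = sqrt (max 0 (r - 1 / c n))"
    have "max 0 (r - 1 / c n) < r" using c[of n] r by auto
    then have "\<rho> < sqrt r" unfolding \<rho>_def by simp
    then have "\<rho> < R" using R by (simp add: r_def)
    moreover have "\<phi> n x = 0" if "x \<notin> cball 0 \<rho>" for x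
    proof -
      have "\<rho> < norm x" using that by simp
      then have "\<rho>\<^sup>2 < (norm x)\<^sup>2" by (intro power_strict_mono) (auto simp: \<rho>_def)
      then have "max 0 (r - 1 / c n) < x \<bullet> x"
        by (simp add: \<rho>_def power2_norm_eq_inner)
      then show ?thesis unfolding \<phi>_def by (intro H0) simp
    qed
    ultimately show "\<exists>K. compact K \<and> K \<subseteq> \<Omega> \<and> (\<forall>x. x \<notin> K \<longrightarrow> \<phi> n x = 0)"
      by (intro exI[of _ "cball 0 \<rho>"]) (auto simp: \<Omega>_def)
  qed
  have g\<phi>: "grad (\<phi> n) x = (2 * \<psi> n (x \<bullet> x)) *\<^sub>R x" for n x
    using test_function_derivative(2)[OF t\<phi>] partial_deriv_eq[OF d\<phi>]
    by (metis euclidean_eqI)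
  have \<eta>1: "\<bar>\<eta> n t\<bar> \<le> 1" for n t
    using flat_nonneg[of 0] flat_0_le_1 by (simp add: \<eta>_def)
  have B: "\<bar>q t - \<psi> n t\<bar> \<le> 2 * Q + 1" if "0 \<le> t" "t \<le> r" for n t
  proof -
    have "1 / c n \<le> 1" using c[of n] by simp
    then have P1: "\<bar>P n t\<bar> \<le> Q + 1"
      using P(2)[OF that, of n, folded c_def] Q[OF that] by linarith
    have "\<bar>\<psi> n t\<bar> \<le> \<bar>P n t\<bar>"
      unfolding \<psi>_def abs_mult using \<eta>1 by (simp add: mult_left_le)
    then show ?thesis using P1 Q[OF that] by linarith
  qed
  have lim\<psi>: "(\<lambda>n. q t - \<psi> n t) \<longlonglongrightarrow> 0" if t: "0 \<le> t" "t < r" for t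
  proof -
    have inv: "(\<lambda>n. 1 / real (Suc n)) \<longlonglongrightarrow> 0"
      using LIMSEQ_inverse_real_of_nat by (simp add: divide_inverse)
    have "(\<lambda>n. P n t - q t) \<longlonglongrightarrow> 0"
      using P(2)[of t] t by (intro Lim_null_comparison[OF _ inv] always_eventually)
        (auto simp: abs_minus_commute intro: less_imp_le)
    then have P: "(\<lambda>n. P n t) \<longlonglongrightarrow> q t" by (rule LIM_zero_cancel)
    have "(\<lambda>n. \<eta> n t) \<longlonglongrightarrow> exp 0"
    proof (rule Lim_transform_eventually)
      have "filterlim (\<lambda>n. real (Suc n)) at_top sequentially"
        by (rule filterlim_compose[OF filterlim_real_sequentially filterlim_Suc])
      then have "filterlim (\<lambda>n. (r - t) * real (Suc n)) at_top sequentially"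
        using t by (intro filterlim_tendsto_pos_mult_at_top[OF tendsto_const]) auto
      then have top: "filterlim (\<lambda>n. - 1 + (r - t) * real (Suc n)) at_top sequentially"
        by (rule filterlim_tendsto_add_at_top[OF tendsto_const])
      then have "(\<lambda>n. - 1 / (- 1 + (r - t) * real (Suc n))) \<longlonglongrightarrow> 0"
        by (intro tendsto_divide_0[OF tendsto_const] filterlim_at_top_imp_at_infinity)
      then show "(\<lambda>n. exp (- 1 / (- 1 + (r - t) * real (Suc n)))) \<longlonglongrightarrow> exp 0"
        by (rule tendsto_exp)
      have "\<forall>\<^sub>F n in sequentially. 0 < - 1 + (r - t) * real (Suc n)"
        using top unfolding filterlim_at_top_dense by blast
      then show "\<forall>\<^sub>F n in sequentially.
          exp (- 1 / (- 1 + (r - t) * real (Suc n))) = \<eta> n t"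
      proof eventually_elim
        case (elim n)
        moreover have "(c n * r - 1) + (- c n) * t = - 1 + (r - t) * real (Suc n)"
          unfolding c_def by (simp only: ring_distribs mult.commute)
        ultimately show ?case unfolding \<eta>_def flat_def by simp
      qed
    qed
    then have "(\<lambda>n. q t - P n t * \<eta> n t) \<longlonglongrightarrow> q t - q t * exp 0"
      by (intro tendsto_intros P)
    then show ?thesis by (simp add: \<psi>_def)
  qed
  have dUH: "((\<lambda>t. U t - H n t) has_real_derivative q t - \<psi> n t) (at t)" if "0 \<le> t" for n t
    using U(1)[OF that] H(1)[OF that] by (rule DERIV_diff)
  have UH0: "U r - H n r = 0" for n using U(2) H(2) by (simp add: r_def)
  note UH = antiderivative_bounded_tendsto_0[of "\<lambda>n t. U t - H n t", OF dUH UH0 B lim\<psi>]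
  have nx: "norm x \<le> R" if "x \<in> \<Omega>" for x using that by (simp add: \<Omega>_def)
  have Q0: "0 \<le> Q" using Q[of 0] r by linarith
  have compact_bounded: "\<exists>A. \<forall>x\<in>K. norm (g x) \<le> A"
    if "continuous_on UNIV g" "compact K" for g :: "'a \<Rightarrow> 'c::real_normed_vector" and K
    using compact_imp_bounded[OF compact_continuous_image[OF continuous_on_subset[OF that(1)] that(2)]]
    by (auto simp: bounded_iff)
  have cball: "\<Omega> \<subseteq> cball 0 R" "compact (cball (0::'a) R)" by (auto simp: \<Omega>_def)
  have Lp: "in_Lp p \<Omega> g" if "continuous_on UNIV g" for g :: "'a \<Rightarrow> 'c::euclidean_space"
    using compact_bounded[OF that cball(2)] cball(1) that p \<Omega>
    by (meson borel_measurable_lebesgue_on_continuous in_Lp_bounded order_trans subsetD zero_le_one)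
  have abs_int: "g absolutely_integrable_on K"
    if "continuous_on UNIV g" "compact K" for g :: "'a \<Rightarrow> 'c::euclidean_space" and K
  proof -
    have "integrable (lebesgue_on K) g"
      using compact_bounded[OF that] that lmeasurable_compact[OF that(2)]
      by (auto intro: integrable_lebesgue_on_bounded borel_measurable_lebesgue_on_continuous)
    then show ?thesis
      using lmeasurable_compact[OF that(2)]
      by (simp add: set_integrable_def integrable_restrict_space fmeasurableD)
  qed
  have weak: "has_weak_gradient \<Omega> u Du"
    unfolding has_weak_gradient_def
  proof (intro conjI allI impI ballI)
    fix K assume "compact K \<and> K \<subseteq> \<Omega>"
    then show "u absolutely_integrable_on K" "Du absolutely_integrable_on K"
      using abs_int cu cDu by auto
  next
    fix f and b :: 'a assume f: "test_function \<Omega> f" and "b \<in> Basis"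
    show "integral\<^sup>L (lebesgue_on \<Omega>) (\<lambda>x. u x * partial_deriv b f x) =
        - integral\<^sup>L (lebesgue_on \<Omega>) (\<lambda>x. (Du x \<bullet> b) * f x)"
      unfolding test_function_derivative(2)[OF f]
      by (rule integration_by_parts_test_function(3)[OF f fmeasurableD[OF \<Omega>] du])
        (intro continuous_intros cDu)
  qed
  have "(\<lambda>n. Lp_norm p \<Omega> (\<lambda>x. u x - \<phi> n x)) \<longlonglongrightarrow> 0"
  proof (rule Lp_norm_bounded_tendsto_0[OF \<Omega>, where B = "r * (2 * Q + 1)"])
    have "continuous_on UNIV (\<phi> n)" for n
      using test_function_derivative(4)[OF t\<phi>] .
    then show "(\<lambda>x. u x - \<phi> n x) \<in> borel_measurable (lebesgue_on \<Omega>)" for n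
      using cu by (intro borel_measurable_lebesgue_on_continuous continuous_intros) auto
    show "norm (u x - \<phi> n x) \<le> r * (2 * Q + 1)" if "x \<in> \<Omega>" for n x
      using UH(2)[of "x \<bullet> x" n] in\<Omega>[OF that] by (simp add: u_def \<phi>_def)
    show "(\<lambda>n. u x - \<phi> n x) \<longlonglongrightarrow> 0" if "x \<in> \<Omega>" for x
      using UH(1)[of "x \<bullet> x"] in\<Omega>[OF that] by (simp add: u_def \<phi>_def)
  qed (use p in auto)
  moreover have "(\<lambda>n. Lp_norm p \<Omega> (\<lambda>x. Du x - grad (\<phi> n) x)) \<longlonglongrightarrow> 0"
  proof (rule Lp_norm_bounded_tendsto_0[OF \<Omega>, where B = "2 * (2 * Q + 1) * R"])
    have *: "Du x - grad (\<phi> n) x = (2 * (q (x \<bullet> x) - \<psi> n (x \<bullet> x))) *\<^sub>R x" for n x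
      by (simp add: Du_def g\<phi> algebra_simps)
    show "(\<lambda>x. Du x - grad (\<phi> n) x) \<in> borel_measurable (lebesgue_on \<Omega>)" for n
      using cDu test_function_derivative(3)[OF t\<phi>]
      by (intro borel_measurable_lebesgue_on_continuous continuous_intros) auto
    show "norm (Du x - grad (\<phi> n) x) \<le> 2 * (2 * Q + 1) * R" if "x \<in> \<Omega>" for n x
      using B[of "x \<bullet> x" n] in\<Omega>[OF that] nx[OF that] Q0 R unfolding *
      by (auto simp: abs_mult intro!: mult_mono)
    show "(\<lambda>n. Du x - grad (\<phi> n) x) \<longlonglongrightarrow> 0" if "x \<in> \<Omega>" for x
    proof -
      have "(\<lambda>n. (2 * (q (x \<bullet> x) - \<psi> n (x \<bullet> x))) *\<^sub>R x) \<longlonglongrightarrow> (2 * 0) *\<^sub>R x"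
        using lim\<psi>[of "x \<bullet> x"] in\<Omega>[OF that] by (intro tendsto_intros) auto
      then show ?thesis unfolding * by simp
    qed
  qed (use p in auto)
  ultimately have "W1p_zero p \<Omega> u Du"
    unfolding W1p_zero_def W1p_def using weak Lp[OF cu] Lp[OF cDu] t\<phi> by blast
  then show ?thesis unfolding \<Omega>_def u_def Du_def .
qed

subsection \<open>A continuously differentiable step function\<close>

lemma DERIV_max_0_square:
  fixes c s :: real
  shows "((\<lambda>s. (max 0 (s - c))\<^sup>2) has_real_derivative 2 * max 0 (s - c)) (at s)"
proof -
  have "((\<lambda>s::real. (max 0 s)\<^sup>2) has_real_derivative 2 * max 0 s) (at s)" for s
  proof -
    consider "s > 0" | "s < 0" | "s = 0" by linarith
    then show ?thesis
    proof cases
      case 1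
      have "((\<lambda>s::real. s\<^sup>2) has_real_derivative 2 * max 0 s) (at s)"
        using 1 by (auto intro!: derivative_eq_intros)
      then show ?thesis
        by (rule has_field_derivative_transform_within_open[of _ _ _ "{0<..}"]) (use 1 in auto)
    next
      case 2
      have "((\<lambda>s::real. 0) has_real_derivative 2 * max 0 s) (at s)"
        using 2 by (auto intro!: derivative_eq_intros)
      then show ?thesis
        by (rule has_field_derivative_transform_within_open[of _ _ _ "{..<0}"]) (use 2 in auto)
    next
      case 3
      have "((\<lambda>h. (max 0 h)\<^sup>2 / h) \<longlongrightarrow> 0) (at (0::real))"
      proof (rule tendsto_cong[THEN iffD2])
        show "\<forall>\<^sub>F h in at 0. (max 0 h)\<^sup>2 / h = max 0 (h::real)"
          by (auto simp: eventually_at_filter max_def power2_eq_square)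
        show "((\<lambda>h. max 0 h) \<longlongrightarrow> 0) (at (0::real))"
          using tendsto_max[OF tendsto_const tendsto_ident_at, of 0 "0::real" UNIV] by simp
      qed
      then show ?thesis using 3 by (simp add: has_field_derivative_iff)
    qed
  qed
  moreover have "((\<lambda>s. s - c) has_real_derivative 1) (at s)"
    by (auto intro!: derivative_eq_intros)
  ultimately have "((\<lambda>s. (max 0 (s - c))\<^sup>2) has_real_derivative 2 * max 0 (s - c) * 1) (at s)"
    by (rule DERIV_chain2)
  then show ?thesis by simp
qed

text \<open>A quadratic spline with knots 0, 1/2, 1 in truncated powers: it equals 2 s^2 on [0, 1/2]
  and 1 - 2 (1 - s)^2 on [1/2, 1]. The term s - 0 gives all three summands the shape of
  \<open>DERIV_max_0_square\<close>.\<close>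

definition step :: "real \<Rightarrow> real" where
  "step s = 2 * ((max 0 (s - 0))\<^sup>2 - 2 * (max 0 (s - 1 / 2))\<^sup>2 + (max 0 (s - 1))\<^sup>2)"

definition step_deriv :: "real \<Rightarrow> real" where
  "step_deriv s = 4 * (max 0 s - 2 * max 0 (s - 1 / 2) + max 0 (s - 1))"

lemma DERIV_step: "(step has_real_derivative step_deriv s) (at s)"
  unfolding step_def[abs_def] step_deriv_def
  by (rule derivative_eq_intros DERIV_max_0_square refl)+ simp

lemma step_eq_0: "s \<le> 0 \<Longrightarrow> step s = 0"
  by (simp add: step_def)

lemma step_eq_1: "1 \<le> s \<Longrightarrow> step s = 1"
  by (simp add: step_def max_def power2_eq_square algebra_simps)

lemma step_nonneg: "0 \<le> step s"
proof -
  consider "s \<le> 1 / 2" | "1 / 2 \<le> s" "s \<le> 1" | "1 \<le> s" by linarith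
  then show ?thesis
  proof cases
    case 2
    have "step s = 1 - 2 * (1 - s)\<^sup>2"
      using 2 by (simp add: step_def max_def power2_eq_square algebra_simps)
    moreover have "(1 - s)\<^sup>2 \<le> (1 / 2)\<^sup>2" using 2 by (intro power_mono) auto
    ultimately show ?thesis by (simp add: power2_eq_square)
  next
    case 3
    then show ?thesis using step_eq_1 by simp
  qed (simp add: step_def)
qed

lemma step_deriv_bounds: "0 \<le> step_deriv s" "step_deriv s \<le> 2"
  by (auto simp: step_deriv_def max_def)

lemma step_deriv_eq_0: "s \<le> 0 \<or> 1 \<le> s \<Longrightarrow> step_deriv s = 0"
  by (auto simp: step_deriv_def max_def)

lemma continuous_on_step: "continuous_on A step" "continuous_on A step_deriv"
  unfolding step_def[abs_def] step_deriv_def[abs_def] by (intro continuous_intros; simp)+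

subsection \<open>Radial solutions with concentrated weights\<close>

text \<open>Disposes of the singularity of the powers of t at 0: they are multiplied by a step that
  vanishes to the left of a.\<close>

lemma continuous_on_UNIV_glue:
  fixes h :: "real \<Rightarrow> real"
  assumes "0 < a" "continuous_on {0<..} h" "\<And>t. t < a \<Longrightarrow> h t = 0"
  shows "continuous_on UNIV h"
proof -
  have "continuous_on {..<a} h"
    by (rule continuous_on_eq[of _ "\<lambda>_. 0"]) (use assms(3) in auto)
  then have "continuous_on ({0<..} \<union> {..<a}) h"
    using assms(2) by (intro continuous_on_open_Un) auto
  moreover have "{0<..} \<union> {..<a} = UNIV" using assms(1) by auto
  ultimately show ?thesis by simp
qed

lemma continuous_on_step_powr:
  assumes "0 < a" "0 < \<alpha>"
  shows "continuous_on UNIV (\<lambda>t. step ((t - a) / a) powr \<alpha> * t powr \<beta>)"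
proof -
  have "continuous_on {0<..} (\<lambda>t. step ((t - a) / a))"
    using assms(1) by (auto intro!: continuous_intros continuous_on_compose2[OF continuous_on_step(1)])
  moreover have "step ((t - a) / a) = 0" if "t < a" for t
    using that assms(1) by (auto intro!: step_eq_0 simp: divide_le_0_iff)
  ultimately show ?thesis
    using assms step_nonneg
    by (intro continuous_on_UNIV_glue[OF assms(1)] continuous_on_mult continuous_on_powr')
      (auto intro!: continuous_intros)
qed

lemma continuous_on_step_deriv_powr:
  assumes "0 < a"
  shows "continuous_on UNIV (\<lambda>t. step_deriv ((t - a) / a) * t powr \<beta>)"
proof -
  have "continuous_on {0<..} (\<lambda>t. step_deriv ((t - a) / a))"
    using assms by (auto intro!: continuous_intros continuous_on_compose2[OF continuous_on_step(2)])
  moreover have "step_deriv ((t - a) / a) = 0" if "t < a" for t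
    using that assms by (auto intro!: step_deriv_eq_0 simp: divide_le_0_iff)
  ultimately show ?thesis
    by (intro continuous_on_UNIV_glue[OF assms] continuous_on_mult continuous_on_powr')
      (auto intro!: continuous_intros)
qed

text \<open>Each component m(|x|^2) x_b of the field is integrated by parts separately. Summing over
  the basis produces the divergence N m(t) + 2 t m'(t) at t = |x|^2.\<close>

lemma radial_divergence_theorem:
  fixes m m' :: "real \<Rightarrow> real" and \<phi> :: "'a::euclidean_space \<Rightarrow> real"
  assumes \<phi>: "test_function \<Omega> \<phi>" and \<Omega>: "\<Omega> \<in> sets lebesgue"
    and m: "\<And>t. 0 \<le> t \<Longrightarrow> (m has_real_derivative m' t) (at t)" "continuous_on UNIV m'"
  shows "integral\<^sup>L (lebesgue_on \<Omega>) (\<lambda>x. (- m (x \<bullet> x) *\<^sub>R x) \<bullet> grad \<phi> x) =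
    integral\<^sup>L (lebesgue_on \<Omega>) (\<lambda>x. (DIM('a) * m (x \<bullet> x) + 2 * (x \<bullet> x) * m' (x \<bullet> x)) * \<phi> x)"
proof -
  define v where "v b x = m (x \<bullet> x) * (x \<bullet> b)" for b x :: 'a
  define v' where "v' b x y = m (x \<bullet> x) * (y \<bullet> b) + (m' (x \<bullet> x) * (2 * (x \<bullet> y))) * (x \<bullet> b)"
    for b x y :: 'a
  have dm: "((\<lambda>x. m (x \<bullet> x)) has_derivative (\<lambda>y. m' (x \<bullet> x) * (2 * (x \<bullet> y)))) (at x)" for x :: 'a
    by (rule has_derivative_radial[where H = m and h = m', OF m(1)]) simp
  have dv: "(v b has_derivative v' b x) (at x)" for b x
    unfolding v_def v'_def
    by (rule has_derivative_mult[OF dm]) (auto intro!: derivative_eq_intros)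
  have cm: "continuous_on UNIV (\<lambda>x::'a. m (x \<bullet> x))"
    using dm by (meson continuous_at_imp_continuous_on has_derivative_continuous)
  have cv': "continuous_on UNIV (\<lambda>x. v' b x b)" for b
    unfolding v'_def
    by (intro continuous_intros cm continuous_on_compose2[OF m(2)]) auto
  note ibp = integration_by_parts_test_function[OF \<phi> \<Omega> dv cv']
  have "(- m (x \<bullet> x) *\<^sub>R x) \<bullet> grad \<phi> x = (\<Sum>b\<in>Basis. - (v b x * (grad \<phi> x \<bullet> b)))" for x
    by (simp add: v_def euclidean_inner[of x "grad \<phi> x"] sum_negf sum_distrib_left mult.assoc)
  then have "integral\<^sup>L (lebesgue_on \<Omega>) (\<lambda>x. (- m (x \<bullet> x) *\<^sub>R x) \<bullet> grad \<phi> x) =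
      (\<Sum>b\<in>Basis. integral\<^sup>L (lebesgue_on \<Omega>) (\<lambda>x. - (v b x * (grad \<phi> x \<bullet> b))))"
    using ibp(1) by (simp only:) (rule Bochner_Integration.integral_sum, simp)
  also have "\<dots> = (\<Sum>b\<in>Basis. integral\<^sup>L (lebesgue_on \<Omega>) (\<lambda>x. v' b x b * \<phi> x))"
    using ibp(3) by simp
  also have "\<dots> = integral\<^sup>L (lebesgue_on \<Omega>) (\<lambda>x. \<Sum>b\<in>Basis. v' b x b * \<phi> x)"
    using ibp(2) by (intro Bochner_Integration.integral_sum[symmetric])
  also have "(\<lambda>x. \<Sum>b\<in>Basis. v' b x b * \<phi> x) =
      (\<lambda>x. (DIM('a) * m (x \<bullet> x) + 2 * (x \<bullet> x) * m' (x \<bullet> x)) * \<phi> x)"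
  proof
    fix x
    have "(\<Sum>b\<in>Basis. v' b x b) = (\<Sum>b\<in>(Basis::'a set). m (x \<bullet> x)) +
        2 * m' (x \<bullet> x) * (\<Sum>b\<in>Basis. (x \<bullet> b) * (x \<bullet> b))"
      by (simp add: v'_def sum.distrib sum_distrib_left mult_ac)
    also have "\<dots> = DIM('a) * m (x \<bullet> x) + 2 * (x \<bullet> x) * m' (x \<bullet> x)"
      by (simp add: euclidean_inner[of x x])
    finally show "(\<Sum>b\<in>Basis. v' b x b * \<phi> x) =
        (DIM('a) * m (x \<bullet> x) + 2 * (x \<bullet> x) * m' (x \<bullet> x)) * \<phi> x"
      by (simp flip: sum_distrib_right)
  qed
  finally show ?thesis .
qed

text \<open>The constant collects three estimates: 8 bounds a^(N/2) times the divergence, the power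
  of 4 comes from the lower bound L for u, and the rest is the volume of the ball of radius sqrt
  (2a) divided by a^(N/2).\<close>

lemma concentrated_weight:
  fixes p a R :: real
  assumes p: "1 < p" and a: "0 < a" and R: "0 < R" "4 * a \<le> R\<^sup>2"
  defines "N \<equiv> real DIM('a::euclidean_space)"
  obtains w u B where
    "w \<in> borel_measurable (lebesgue_on (ball (0::'a) R))" "\<And>x. \<bar>w x\<bar> \<le> B" "\<And>x. 0 \<le> w x"
    "weak_solution p (ball 0 R) w u" "nontrivial_on (ball 0 R) u"
    "integral\<^sup>L (lebesgue_on (ball 0 R)) w \<le>
      8 * 4 powr ((N + p - 2) / 2) * 2 powr (N / 2) * unit_ball_vol N * a powr ((N - p) / 2)"
proof -
  define \<Omega> where "\<Omega> = ball (0::'a) R"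
  have \<Omega>: "\<Omega> \<in> lmeasurable" by (simp add: \<Omega>_def)
  have N1: "1 \<le> N" unfolding N_def using DIM_positive[where 'a = 'a] by linarith
  \<comment> \<open>Away from the inner ball the gradient has length |x|^(1 - 2 \<sigma>) =
    |x|^(-(N-1)/(p-1)), as for a radial p-harmonic function.\<close>
  define \<sigma> where "\<sigma> = (N + p - 2) / (2 * (p - 1))"
  have \<sigma>p: "\<sigma> * (p - 1) = (N + p - 2) / 2"
  proof -
    have *: "x / (2 * y) * y = x / 2" if "y \<noteq> 0" for x y :: real
      using that by simp
    show ?thesis unfolding \<sigma>_def by (rule *) (use p in simp)
  qed
  have \<sigma>0: "0 < \<sigma>" using p N1 by (simp add: \<sigma>_def)
  define G where "G t = step ((t - a) / a)" for t
  define G' where "G' t = step_deriv ((t - a) / a) / a" for t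
  have dG: "(G has_real_derivative G' t) (at t)" for t
  proof -
    have "((\<lambda>t. (t - a) / a) has_real_derivative (1 - 0) / a) (at t)"
      by (intro DERIV_cdivide DERIV_diff DERIV_ident DERIV_const)
    from DERIV_chain2[OF DERIV_step this] show ?thesis
      unfolding G_def G'_def by simp
  qed
  have G_0: "G t = 0" "G' t = 0" if "t \<le> a" for t
    using that a by (auto simp: G_def G'_def divide_le_0_iff intro!: step_eq_0 step_deriv_eq_0)
  have G_1: "G t = 1" "G' t = 0" if "2 * a \<le> t" for t
    using that a by (auto simp: G_def G'_def le_divide_eq intro!: step_eq_1 step_deriv_eq_0)
  have G0: "0 \<le> G t" "0 \<le> G' t" "G' t \<le> 2 / a" for t
    using a step_deriv_bounds[of "(t - a) / a"] step_nonneg[of "(t - a) / a"]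
    by (auto simp: G_def G'_def intro!: divide_right_mono)
  \<comment> \<open>The gradient of u will be -q(|x|^2) x, and -m(|x|^2) x the corresponding field.
    The exponent 1 / (p - 1) inverts the map z |-> |z|^(p-2) z on lengths, so that the step G enters
    m to the first power.\<close>
  define q where "q t = G t powr (1 / (p - 1)) * t powr (- \<sigma>)" for t
  define m where "m t = G t * t powr (- N / 2)" for t
  define m' where "m' t = G' t * t powr (- N / 2) + G t * ((- N / 2) * t powr (- N / 2 - 1))" for t
  have q_cont: "continuous_on UNIV q"
    unfolding q_def G_def using p a by (intro continuous_on_step_powr) auto
  have q0: "0 \<le> q t" for t by (simp add: q_def)
  \<comment> \<open>At t = 0 the powers of t only have their default value; there the derivative
    comes from G being 0 to the left of a.\<close>
  have m_deriv: "(m has_real_derivative m' t) (at t)" if "0 \<le> t" for t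
  proof (cases "t = 0")
    case True
    have "((\<lambda>_. 0) has_real_derivative 0) (at t)" by simp
    then have "(m has_real_derivative 0) (at t)"
      by (rule has_field_derivative_transform_within_open[of _ _ _ "{..<a}"])
        (use a True in \<open>auto simp: m_def G_0\<close>)
    then show ?thesis using True a by (simp add: m'_def G_0)
  next
    case False
    then show ?thesis
      unfolding m_def[abs_def] m'_def
      using that by (auto intro!: derivative_eq_intros dG)
  qed
  have m'_cont: "continuous_on UNIV m'"
  proof -
    have "m' = (\<lambda>t. (1 / a) * (step_deriv ((t - a) / a) * t powr (- N / 2)) +
        (- N / 2) * (step ((t - a) / a) powr 1 * t powr (- N / 2 - 1)))"
      using step_nonneg by (auto simp: m'_def G_def G'_def)
    then show ?thesis
      by (simp only:) (intro continuous_on_add continuous_on_mult_left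
          continuous_on_step_powr[OF a] continuous_on_step_deriv_powr[OF a] zero_less_one)
  qed
  \<comment> \<open>The factor 1/2 offsets the derivative 2x of |x|^2, and the sign makes u decrease
    outwards.\<close>
  obtain U where dU: "\<And>t. 0 \<le> t \<Longrightarrow> (U has_real_derivative - q t / 2) (at t)" and UR: "U (R\<^sup>2) = 0"
    using antiderivative_nonneg[of "\<lambda>t. - q t / 2" "R\<^sup>2"] q_cont by (force intro: continuous_intros)
  define u where "u x = U (x \<bullet> x)" for x :: 'a
  define Du where "Du x = (2 * (- q (x \<bullet> x) / 2)) *\<^sub>R x" for x :: 'a
  have W: "W1p_zero p \<Omega> u Du"
    unfolding u_def[abs_def] Du_def[abs_def] \<Omega>_def
    using p R dU UR q_cont
    by (intro W1p_zero_radial[where q = "\<lambda>t. - q t / 2"]) (auto intro!: continuous_intros)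
  \<comment> \<open>By the mean value theorem U drops between 2a and 4a by a q(z) for some z in
    between, and q(z) >= (4a)^(-\<sigma>) there. As 4a <= R^2, U is still non-negative at
    4a.\<close>
  define L where "L = a * (4 * a) powr (- \<sigma>)"
  have L: "0 < L" using a by (simp add: L_def)
  have U_mono: "U t \<le> U s" if "0 \<le> s" "s \<le> t" for s t
    using that dU q0 by (intro DERIV_nonpos_imp_nonincreasing[of s t U])
      (metis (no_types, opaque_lifting) divide_nonpos_pos neg_le_0_iff_le order_trans zero_less_numeral)+
  have U_lower: "L \<le> U t" if "0 \<le> t" "t \<le> 2 * a" for t
  proof -
    have "\<exists>z>2 * a. z < 4 * a \<and> U (4 * a) - U (2 * a) = (4 * a - 2 * a) * (- q z / 2)"
      by (rule MVT2, use a in simp, rule dU) (use a in linarith)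
    then obtain z where z: "2 * a < z" "z < 4 * a" "U (4 * a) - U (2 * a) = - (a * q z)"
      by auto
    have "(4 * a) powr (- \<sigma>) \<le> z powr (- \<sigma>)"
      using z a \<sigma>0 by (intro powr_mono2') auto
    also have "\<dots> = q z" using z by (simp add: q_def G_1)
    finally have "L \<le> a * q z" using a by (simp add: L_def)
    moreover have "0 \<le> U (4 * a)" using U_mono[of "4 * a" "R\<^sup>2"] UR R a by simp
    moreover have "U (2 * a) \<le> U t" using U_mono that by simp
    ultimately show ?thesis using z(3) by linarith
  qed
  \<comment> \<open>This is the divergence of m(|x|^2) x. The contributions of G cancel, because
    |x|^(-N) x is divergence-free off the origin; only the term with G' survives.\<close>
  define f where "f x = 2 * (x \<bullet> x) * (G' (x \<bullet> x) * (x \<bullet> x) powr (- N / 2))" for x :: 'a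
  have f_0: "f x = 0" if "\<not> x \<bullet> x < 2 * a" for x using that by (simp add: f_def G_1)
  have f0: "0 \<le> f x" for x by (simp add: f_def G0)
  have f_le: "f x \<le> 8 * a powr (- N / 2)" for x
  proof (cases "a < x \<bullet> x \<and> x \<bullet> x < 2 * a")
    case True
    have "f x \<le> 2 * (2 * a) * ((2 / a) * a powr (- N / 2))"
      unfolding f_def using True G0 a N1 by (intro mult_mono powr_mono2') auto
    then show ?thesis using a by simp
  next
    case False
    then have "G' (x \<bullet> x) = 0" using G_0[of "x \<bullet> x"] G_1[of "x \<bullet> x"] by linarith
    then show ?thesis by (simp add: f_def)
  qed
  have f_cont: "continuous_on UNIV f"
  proof -
    have "continuous_on UNIV (\<lambda>t. G' t * t powr (- N / 2))"
    proof -
      have "(\<lambda>t. G' t * t powr (- N / 2)) = (\<lambda>t. (1 / a) * (step_deriv ((t - a) / a) * t powr (- N / 2)))"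
        by (auto simp: G'_def)
      then show ?thesis
        by (simp only:) (intro continuous_on_mult_left continuous_on_step_deriv_powr[OF a])
    qed
    then show ?thesis
      unfolding f_def[abs_def]
      by (intro continuous_on_mult continuous_intros
          continuous_on_compose2[OF \<open>continuous_on UNIV (\<lambda>t. G' t * t powr (- N / 2))\<close>]) auto
  qed
  have u_cont: "continuous_on UNIV u"
  proof -
    have "isCont u x" for x
      unfolding u_def[abs_def]
      using has_derivative_radial[where H = U and h = "\<lambda>t. - q t / 2" and x = x, OF dU]
      by (simp add: has_derivative_continuous)
    then show ?thesis by (simp add: continuous_at_imp_continuous_on)
  qed
  define V where "V x = - m (x \<bullet> x) *\<^sub>R x" for x :: 'a
  have V_cont: "continuous_on UNIV V"
  proof -
    have "m = (\<lambda>t. step ((t - a) / a) powr 1 * t powr (- N / 2))"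
      using step_nonneg by (auto simp: m_def G_def)
    then have "continuous_on UNIV m"
      by (simp only:) (rule continuous_on_step_powr[OF a zero_less_one])
    then show ?thesis
      unfolding V_def[abs_def]
      by (intro continuous_intros continuous_on_compose2[OF \<open>continuous_on UNIV m\<close>]) auto
  qed
  \<comment> \<open>The exponents of G add up to 1 and those of t to -N/2, by the choice of q and
    \<sigma>. Where G vanishes, so do m and \<open>Du\<close>, and both sides are 0 also for p <
    2.\<close>
  have V_eq: "V x = norm (Du x) powr (p - 2) *\<^sub>R Du x" for x
  proof (cases "G (x \<bullet> x) = 0")
    case True
    then show ?thesis by (simp add: V_def Du_def m_def q_def)
  next
    case False
    define t where "t = x \<bullet> x"
    have t: "0 < t" using False G_0[of t] a unfolding t_def by force
    have g: "0 < G t" using False G0(1)[of t] by (simp add: t_def)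
    have nx: "norm x = t powr (1 / 2)"
      by (simp add: t_def norm_eq_sqrt_inner powr_half_sqrt)
    have "norm (Du x) = q t * t powr (1 / 2)"
      using q0[of t] by (simp add: Du_def nx t_def[symmetric])
    also have "\<dots> = G t powr (1 / (p - 1)) * t powr (1 / 2 - \<sigma>)"
      by (simp add: q_def powr_add[symmetric])
    finally have "norm (Du x) powr (p - 2) * q t =
        (G t powr (1 / (p - 1) * (p - 2)) * t powr ((1 / 2 - \<sigma>) * (p - 2))) *
        (G t powr (1 / (p - 1)) * t powr (- \<sigma>))"
      by (simp add: powr_mult powr_powr q_def)
    also have "\<dots> = G t powr (1 / (p - 1) * (p - 2) + 1 / (p - 1)) *
        t powr ((1 / 2 - \<sigma>) * (p - 2) + - \<sigma>)"
      by (simp only: powr_add mult_ac)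
    also have "1 / (p - 1) * (p - 2) + 1 / (p - 1) = 1"
      using p by (simp add: field_simps)
    also have "(1 / 2 - \<sigma>) * (p - 2) + - \<sigma> = - N / 2"
      using \<sigma>p by (simp add: field_simps)
    finally show ?thesis
      using g by (simp add: V_def Du_def m_def t_def[symmetric])
  qed
  \<comment> \<open>Where f is nonzero, |x|^2 < 2a and hence u >= L > 0. Elsewhere the quotient is 0
    whatever the value of u, including points on or beyond the boundary sphere.\<close>
  define w where "w x = f x / u x powr (p - 1)" for x
  have w0: "0 \<le> w x" for x using f0 by (simp add: w_def)
  define A where "A = 8 * a powr (- N / 2) / L powr (p - 1)"
  have A0: "0 \<le> A" by (simp add: A_def)
  \<comment> \<open>Replacing the shell by the full ball of radius sqrt (2a) only affects the
    constant.\<close>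
  have w_le: "w x \<le> A * indicator (ball 0 (sqrt (2 * a))) x" for x
  proof (cases "x \<bullet> x < 2 * a")
    case True
    have "L powr (p - 1) \<le> u x powr (p - 1)"
      using True U_lower[of "x \<bullet> x"] p L by (intro powr_mono2) (auto simp: u_def)
    then have "w x \<le> A"
      unfolding w_def A_def using f_le f0 L by (intro frac_le) auto
    moreover have "x \<in> ball 0 (sqrt (2 * a))"
      using True by (simp add: norm_eq_sqrt_inner)
    ultimately show ?thesis by simp
  next
    case False
    then show ?thesis using f_0[of x] A0 by (simp add: w_def)
  qed
  have w_A: "\<bar>w x\<bar> \<le> A" for x
  proof -
    have "A * indicator (ball 0 (sqrt (2 * a))) x \<le> A"
      using A0 by (simp add: indicator_def)
    then show ?thesis using w_le[of x] w0[of x] by linarith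
  qed
  have w_meas: "w \<in> borel_measurable (lebesgue_on \<Omega>)"
    unfolding w_def[abs_def]
    using borel_measurable_lebesgue_on_continuous[OF f_cont]
      borel_measurable_lebesgue_on_continuous[OF u_cont] by measurable
  have "compact (V ` cball 0 R)"
    by (intro compact_continuous_image continuous_on_subset[OF V_cont]) auto
  then obtain B where B: "\<And>x. x \<in> cball 0 R \<Longrightarrow> norm (V x) \<le> B"
    using compact_imp_bounded bounded_iff by (metis imageI)
  have weak: "weak_solution p \<Omega> w u"
  proof (rule weak_solutionI[OF \<Omega> _ W, where V = V and f = f])
    show "1 \<le> p" using p by simp
    show "V \<in> borel_measurable (lebesgue_on \<Omega>)" "f \<in> borel_measurable (lebesgue_on \<Omega>)"
      using V_cont f_cont by (auto intro: borel_measurable_lebesgue_on_continuous)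
    show "norm (V x) \<le> B" if "x \<in> \<Omega>" for x
      using that B by (simp add: \<Omega>_def)
    show "norm (f x) \<le> 8 * a powr (- N / 2)" for x using f_le[of x] f0[of x] by simp
    show "f x = w x * \<bar>u x\<bar> powr (p - 2) * u x" for x
    proof (cases "x \<bullet> x < 2 * a")
      case True
      then have "0 < u x" using U_lower[of "x \<bullet> x"] L by (simp add: u_def)
      moreover from this have "u x powr (p - 2) * u x = u x powr (p - 1)"
        by (simp add: powr_mult_base mult.commute)
      ultimately show ?thesis by (simp add: w_def mult.assoc)
    qed (simp add: f_0 w_def)
    show "integral\<^sup>L (lebesgue_on \<Omega>) (\<lambda>x. V x \<bullet> grad \<phi> x) =
        integral\<^sup>L (lebesgue_on \<Omega>) (\<lambda>x. f x * \<phi> x)" if \<phi>: "test_function \<Omega> \<phi>" for \<phi>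
    proof -
      have "N * m t + 2 * t * m' t = 2 * t * (G' t * t powr (- N / 2))" if "0 \<le> t" for t
      proof (cases "t = 0")
        case False
        then have "t powr (- N / 2) = t * t powr (- N / 2 - 1)"
          using that powr_mult_base[of t "- N / 2 - 1"] by simp
        then show ?thesis by (simp add: m_def m'_def algebra_simps)
      qed (use a in \<open>simp add: m_def G_0\<close>)
      then have "f = (\<lambda>x. real DIM('a) * m (x \<bullet> x) + 2 * (x \<bullet> x) * m' (x \<bullet> x))"
        by (auto simp: f_def N_def)
      then show ?thesis
        unfolding V_def
        using radial_divergence_theorem[OF \<phi> fmeasurableD[OF \<Omega>] m_deriv m'_cont] by simp
    qed
  qed (rule V_eq)
  define S where "S = ball (0::'a) (sqrt (2 * a))"
  have "sqrt (2 * a) < sqrt (R\<^sup>2)" using a R by (intro real_sqrt_less_mono) linarith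
  then have S: "S \<subseteq> \<Omega>" using R by (auto simp: S_def \<Omega>_def)
  have nontriv: "nontrivial_on \<Omega> u"
    unfolding nontrivial_on_def
  proof
    assume "AE x in lebesgue_on \<Omega>. u x = 0"
    then have "AE x in lebesgue. x \<in> \<Omega> \<longrightarrow> u x = 0"
      using \<Omega> by (simp add: AE_restrict_space_iff fmeasurableD)
    then have "AE x in lebesgue. x \<notin> S"
    proof eventually_elim
      case (elim x)
      have False if "x \<in> S"
      proof -
        have "x \<bullet> x < 2 * a" using that by (simp add: S_def norm_eq_sqrt_inner)
        then have "0 < u x" using U_lower[of "x \<bullet> x"] L by (simp add: u_def)
        then show False using elim that S by auto
      qed
      then show ?case by blast
    qed
    then have "S \<in> null_sets lebesgue"
      by (subst AE_iff_null_sets) (auto simp: S_def)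
    then have "measure lebesgue S = 0" by (simp add: measure_eq_0_null_sets)
    then show False using a by (simp add: S_def)
  qed
  have int: "integral\<^sup>L (lebesgue_on \<Omega>) w \<le> A * measure lborel S"
  proof -
    have "integrable (lebesgue_on \<Omega>) w"
    proof (rule integrable_lebesgue_on_bounded[OF \<Omega> w_meas])
      show "norm (w x) \<le> A" for x
        using w_A by simp
    qed
    moreover have "integrable (lebesgue_on \<Omega>) (\<lambda>x. A * indicator S x)"
    proof (rule integrable_lebesgue_on_bounded[OF \<Omega>, where B = A])
      have "S \<in> sets lebesgue" by (simp add: S_def)
      then show "(\<lambda>x. A * indicator S x) \<in> borel_measurable (lebesgue_on \<Omega>)"
        by (intro measurable_restrict_space1 borel_measurable_times borel_measurable_const
            borel_measurable_indicator)
      show "norm (A * indicator S x) \<le> A" for x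
        using A0 by (simp add: indicator_def)
    qed
    ultimately have "integral\<^sup>L (lebesgue_on \<Omega>) w \<le> integral\<^sup>L (lebesgue_on \<Omega>) (\<lambda>x. A * indicator S x)"
      using w_le by (intro integral_mono) (auto simp: S_def)
    also have "\<dots> = A * measure (lebesgue_on \<Omega>) (S \<inter> space (lebesgue_on \<Omega>))"
      by simp
    also have "\<dots> = A * measure lborel S"
      using S \<Omega> by (simp add: measure_restrict_space fmeasurableD Int_absorb2 S_def)
    finally show ?thesis .
  qed
  have "A * measure lborel S = 8 * 4 powr ((N + p - 2) / 2) * 2 powr (N / 2) * unit_ball_vol N * a powr ((N - p) / 2)"
  proof -
    have c: "measure lborel S = unit_ball_vol N * (2 powr (N / 2) * a powr (N / 2))"
    proof -
      have "sqrt (2 * a) ^ DIM('a) = sqrt (2 * a) powr N"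
        using a by (simp add: N_def powr_realpow)
      also have "\<dots> = (2 * a) powr (N / 2)"
        using a by (simp add: powr_half_sqrt[symmetric] powr_powr)
      finally show ?thesis
        using a by (simp add: S_def content_ball N_def powr_mult)
    qed
    define k \<kappa> where "k = p - 1" and "\<kappa> = (N + p - 2) / 2"
    have A: "A = 8 * a powr (- N / 2) / L powr k" by (simp add: A_def k_def)
    have "L powr k = a powr k * (4 * a) powr (- \<sigma> * k)"
      using a by (simp add: L_def powr_mult powr_powr)
    also have "- \<sigma> * k = - \<kappa>" using \<sigma>p by (simp add: k_def \<kappa>_def)
    finally have l: "L powr k = a powr k * (4 powr (- \<kappa>) * a powr (- \<kappa>))"
      using a by (simp add: powr_mult)
    have "A * measure lborel S = 8 * 4 powr \<kappa> * 2 powr (N / 2) * unit_ball_vol N *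
        (a powr (- N / 2) * a powr (N / 2) * a powr \<kappa> * a powr (- k))"
      unfolding A l c by (simp add: powr_minus divide_simps)
    also have "a powr (- N / 2) * a powr (N / 2) * a powr \<kappa> * a powr (- k) =
        a powr (- N / 2 + N / 2 + \<kappa> + - k)"
      by (simp only: powr_add)
    also have "- N / 2 + N / 2 + \<kappa> + - k = (N - p) / 2"
      by (simp add: k_def \<kappa>_def field_simps)
    finally show ?thesis unfolding \<kappa>_def .
  qed
  then show ?thesis
    using that w_meas w_A w0 weak nontriv int unfolding \<Omega>_def by metis
qed

text \<open>A bounded weight on a ball lies in L^1 and in L^s, the exponent s being positive when p
  < N; this covers both cases of admissibility. K depends only on N and p and is fixed before R and
  a, so a can later be tuned to R, \<beta> and C.\<close>

lemma concentrated_admissible_weight: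
  fixes p :: real
  assumes p: "1 < p" "p \<noteq> real DIM('a::euclidean_space)"
    and s: "p < real DIM('a) \<Longrightarrow> real DIM('a) / p < s"
  obtains K where "0 < K" "\<And>R a. 0 < a \<Longrightarrow> 0 < R \<Longrightarrow> 4 * a \<le> R\<^sup>2 \<Longrightarrow>
    \<exists>w u. admissible_weight p s (ball (0::'a) R) w \<and> (\<forall>x\<in>ball 0 R. 0 \<le> w x) \<and>
      weak_solution p (ball 0 R) w u \<and> nontrivial_on (ball 0 R) u \<and>
      Lp_norm 1 (ball 0 R) w \<le> K * a powr ((real DIM('a) - p) / 2)"
proof
  define N where "N = real DIM('a)"
  define K where "K = 8 * 4 powr ((N + p - 2) / 2) * 2 powr (N / 2) * unit_ball_vol N"
  show "0 < K" by (simp add: K_def N_def)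
  fix R a :: real assume a: "0 < a" "0 < R" "4 * a \<le> R\<^sup>2"
  obtain w u B where w: "w \<in> borel_measurable (lebesgue_on (ball (0::'a) R))"
    "\<And>x. \<bar>w x\<bar> \<le> B" "\<And>x. 0 \<le> w x"
    and u: "weak_solution p (ball 0 R) w u" "nontrivial_on (ball 0 R) u"
    and int: "integral\<^sup>L (lebesgue_on (ball 0 R)) w \<le> K * a powr ((N - p) / 2)"
    using concentrated_weight[OF p(1) a, where 'a = 'a] unfolding K_def N_def by metis
  have "0 < s" if "p < real DIM('a)"
    using s[OF that] p(1) by (smt (verit) divide_nonneg_pos of_nat_0_le_iff)
  then have "admissible_weight p s (ball 0 R) w"
    using w p unfolding admissible_weight_def
    by (auto intro!: in_Lp_bounded[where B = B])
  moreover have "Lp_norm 1 (ball 0 R) w = integral\<^sup>L (lebesgue_on (ball 0 R)) w"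
    using w(3) by (simp add: Lp_norm_def integral_nonneg)
  ultimately show "\<exists>w u. admissible_weight p s (ball (0::'a) R) w \<and> (\<forall>x\<in>ball 0 R. 0 \<le> w x) \<and>
      weak_solution p (ball 0 R) w u \<and> nontrivial_on (ball 0 R) u \<and>
      Lp_norm 1 (ball 0 R) w \<le> K * a powr ((real DIM('a) - p) / 2)"
    using w(3) u int unfolding N_def by metis
qed

section \<open>Choice of the shell parameter a and of the threshold for R\<close>

theorem proposition2p7:
  fixes p s :: real
  assumes "1 < p"
    and "p \<noteq> real DIM('a::euclidean_space)"
    and "p < real DIM('a) \<Longrightarrow> s > real DIM('a) / p"
  shows "(\<forall>\<beta> < gamma_exponent (real DIM('a)) p s. \<forall>C > 0.
            \<exists>R0 \<ge> 1. (p < real DIM('a) \<longrightarrow> R0 = 1) \<and>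
              (\<forall>R > R0. \<exists>w u.
                 admissible_weight p s (ball (0::'a) R) w \<and>
                 (\<forall>x \<in> ball 0 R. 0 \<le> w x) \<and>
                 weak_solution p (ball 0 R) w u \<and>
                 nontrivial_on (ball 0 R) u \<and>
                 \<not> (C / R powr \<beta> \<le> Lp_norm 1 (ball 0 R) w)))
       \<and> (\<forall>\<beta> > gamma_exponent (real DIM('a)) p s. \<forall>C > 0.
            \<exists>R0. 0 < R0 \<and> R0 \<le> 1 \<and> (p < real DIM('a) \<longrightarrow> R0 = 1) \<and>
              (\<forall>R. 0 < R \<and> R < R0 \<longrightarrow> (\<exists>w u.
                 admissible_weight p s (ball (0::'a) R) w \<and>
                 (\<forall>x \<in> ball 0 R. 0 \<le> w x) \<and>
                 weak_solution p (ball 0 R) w u \<and>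
                 nontrivial_on (ball 0 R) u \<and>
                 \<not> (C / R powr \<beta> \<le> Lp_norm 1 (ball 0 R) w))))"
proof -
  define N where "N = real DIM('a)"
  define good where "good \<beta> C R \<longleftrightarrow> (\<exists>w u. admissible_weight p s (ball (0::'a) R) w \<and>
      (\<forall>x \<in> ball 0 R. 0 \<le> w x) \<and> weak_solution p (ball 0 R) w u \<and>
      nontrivial_on (ball 0 R) u \<and> \<not> (C / R powr \<beta> \<le> Lp_norm 1 (ball 0 R) w))" for \<beta> C R
  obtain K where K: "0 < K" "\<And>R a. 0 < a \<Longrightarrow> 0 < R \<Longrightarrow> 4 * a \<le> R\<^sup>2 \<Longrightarrow>
    \<exists>w u. admissible_weight p s (ball (0::'a) R) w \<and> (\<forall>x\<in>ball 0 R. 0 \<le> w x) \<and>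
      weak_solution p (ball 0 R) w u \<and> nontrivial_on (ball 0 R) u \<and>
      Lp_norm 1 (ball 0 R) w \<le> K * a powr ((N - p) / 2)"
    using concentrated_admissible_weight[where 'a = 'a and s = s, OF assms(1,2)] assms(3)
    unfolding N_def by blast
  have good: "good \<beta> C R"
    if prems: "0 < a" "0 < R" "4 * a \<le> R\<^sup>2" "K * a powr ((N - p) / 2) < C / R powr \<beta>" for \<beta> C R a
  proof -
    obtain w u where w: "admissible_weight p s (ball (0::'a) R) w" "\<forall>x\<in>ball 0 R. 0 \<le> w x"
      "weak_solution p (ball 0 R) w u" "nontrivial_on (ball 0 R) u"
      "Lp_norm 1 (ball 0 R) w \<le> K * a powr ((N - p) / 2)"
      using K(2)[OF prems(1-3)] by blast
    then have "\<not> C / R powr \<beta> \<le> Lp_norm 1 (ball 0 R) w" using prems(4) by linarith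
    then show ?thesis unfolding good_def using w by blast
  qed
  \<comment> \<open>For p < N the exponent of a is positive, so with R fixed the bound on the norm
    falls below any positive target as a shrinks. This serves both parts of the theorem with
    threshold 1.\<close>
  have subcritical: "good \<beta> C R" if "p < N" "0 < C" "0 < R" for \<beta> C R
  proof -
    define d where "d = (N - p) / 2"
    define D where "D = C / R powr \<beta>"
    have d: "0 < d" and D: "0 < D" using that by (auto simp: d_def D_def)
    \<comment> \<open>The second entry of the minimum gives K a^d <= D / 2, half the target value;
      the first keeps the shell inside the ball.\<close>
    define a where "a = min (R\<^sup>2 / 4) ((D / (2 * K)) powr (1 / d))"
    have "0 < a" using that D K(1) by (simp add: a_def)
    moreover have "4 * a \<le> R\<^sup>2" by (simp add: a_def)
    moreover have "K * a powr d < D"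
    proof -
      have "a powr d \<le> ((D / (2 * K)) powr (1 / d)) powr d"
        using d \<open>0 < a\<close> by (intro powr_mono2) (auto simp: a_def)
      also have "\<dots> = D / (2 * K)"
        using d D K(1) by (simp add: powr_powr)
      finally have "K * a powr d \<le> K * (D / (2 * K))"
        using K(1) by (intro mult_left_mono) auto
      also have "\<dots> < D" using K(1) D by simp
      finally show ?thesis .
    qed
    ultimately show ?thesis
      using good[of a R] that by (simp add: d_def D_def)
  qed
  define K' where "K' = K * (1 / 4) powr ((N - p) / 2)"
  have K': "0 < K'" using K(1) by (simp add: K'_def)
  \<comment> \<open>For p > N the exponent of a is negative, so the best choice is the largest
    permitted value a = R^2 / 4. The bound becomes K' R^(N-p), and comparing it with C / R^\<beta>
    leaves a condition on a single power of R.\<close>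
  have scaling: "good \<beta> C R" if "0 < R" "K' / C < R powr (p - N - \<beta>)" "0 < C" for \<beta> C R
  proof (rule good)
    show "0 < R\<^sup>2 / 4" "4 * (R\<^sup>2 / 4) \<le> R\<^sup>2" using that by auto
    have e: "2 * ((N - p) / 2) = N - p" by (simp add: field_simps)
    have "R\<^sup>2 / 4 = 1 / 4 * R powr 2" using that by simp
    then have "K * (R\<^sup>2 / 4) powr ((N - p) / 2) = K * ((1 / 4) powr ((N - p) / 2) * R powr (N - p))"
      by (simp only: powr_mult powr_powr e)
    also have "\<dots> = K' * R powr (N - p)" by (simp add: K'_def)
    also have "\<dots> < (C * R powr (p - N - \<beta>)) * R powr (N - p)"
      using that by (intro mult_strict_right_mono) (auto simp: divide_less_eq mult.commute)
    also have "\<dots> = C * R powr (- \<beta>)"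
      by (simp add: mult.assoc flip: powr_add)
    also have "\<dots> = C / R powr \<beta>"
      by (simp add: powr_minus divide_inverse)
    finally show "K * (R\<^sup>2 / 4) powr ((N - p) / 2) < C / R powr \<beta>" .
  qed (use that in auto)
  have "\<exists>R0\<ge>1. (p < N \<longrightarrow> R0 = 1) \<and> (\<forall>R>R0. good \<beta> C R)"
    if \<beta>: "\<beta> < gamma_exponent N p s" and C: "0 < C" for \<beta> C
  proof (cases "p < N")
    case True
    then show ?thesis using subcritical C by (intro exI[of _ 1]) auto
  next
    case False
    then have e: "0 < p - N - \<beta>" using \<beta> assms(2) by (simp add: gamma_exponent_def N_def)
    \<comment> \<open>The second entry solves R^(p-N-\<beta>) = K' / C. Here the exponent is
      positive, so every larger R satisfies the strict inequality.\<close>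
    define R0 where "R0 = max 1 ((K' / C) powr (1 / (p - N - \<beta>)))"
    have "good \<beta> C R" if "R0 < R" for R
    proof (rule scaling[OF _ _ C])
      show "0 < R" using that by (simp add: R0_def)
      have "((K' / C) powr (1 / (p - N - \<beta>))) powr (p - N - \<beta>) < R powr (p - N - \<beta>)"
        using e that by (intro powr_less_mono2) (auto simp: R0_def)
      then show "K' / C < R powr (p - N - \<beta>)"
        using e K' C by (simp add: powr_powr)
    qed
    then show ?thesis using False by (intro exI[of _ R0]) (auto simp: R0_def)
  qed
  moreover have "\<exists>R0. 0 < R0 \<and> R0 \<le> 1 \<and> (p < N \<longrightarrow> R0 = 1) \<and> (\<forall>R. 0 < R \<and> R < R0 \<longrightarrow> good \<beta> C R)"
    if \<beta>: "gamma_exponent N p s < \<beta>" and C: "0 < C" for \<beta> C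
  proof (cases "p < N")
    case True
    then show ?thesis using subcritical C by (intro exI[of _ 1]) auto
  next
    case False
    then have e: "p - N - \<beta> < 0" using \<beta> assms(2) by (simp add: gamma_exponent_def N_def)
    \<comment> \<open>The equation is the same, but the exponent is now negative: the power
      decreases in R and the strict inequality holds below the threshold.\<close>
    define R0 where "R0 = min 1 ((K' / C) powr (1 / (p - N - \<beta>)))"
    have R0: "0 < R0" "R0 \<le> 1" using K' C by (auto simp: R0_def)
    have "good \<beta> C R" if "0 < R" "R < R0" for R
    proof (rule scaling[OF that(1) _ C])
      have "((K' / C) powr (1 / (p - N - \<beta>))) powr (p - N - \<beta>) < R powr (p - N - \<beta>)"
        using e that by (intro powr_less_mono2_neg) (auto simp: R0_def)
      then show "K' / C < R powr (p - N - \<beta>)"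
        using e K' C by (simp add: powr_powr)
    qed
    then show ?thesis using False R0 by (intro exI[of _ R0]) auto
  qed
  ultimately show ?thesis
    unfolding good_def N_def by blast
qed

end
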